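(* Let $K$ be a function field (in the sense below), let $f(z)\in K[z]$ have degree $d\geq 2$, and let $\phi(x,y)=(y,\,x+f(y))$. Then either $\phi$ is isotrivial, or the set $\{P\in\mathbb{A}^2(K):\hat{h}_\phi(P)=0\}$ is finite, with cardinality bounded by a quantity depending only on $d$ and on the number of places of bad reduction of $\phi$. In particular, if $\phi$ is not isotrivial, then for $P\in\mathbb{A}^2(K)$ we have $\hat{h}_\phi(P)=0$ if and only if $P$ is periodic for $\phi$.
   Context: A function field is a field $K$ together with a set $M_K$ of nontrivial non-archimedean absolute values such that for each $x\in K^*$ one has $|x|_v=1$ for all but finitely many $v$ and the product formula $\prod_{v\in M_K}|x|_v=1$ holds; each $v$ is extended to an absolute value on $\overline{K}$. The height of $(x,y)\in\mathbb{A}^2(K)$ is $h(x,y)=\sum_{v\in M_K}\log\max\{1,|x|_v,|y|_v\}$. The canonical heights are $\hat{h}^+_\phi(P)=\lim_{N\to\infty}d^{-N}h(\phi^N(P))$, $\hat{h}^-_\phi(P)=\lim_{N\to\infty}d^{-N}h(\phi^{-N}(P))$, and $\hat{h}_\phi=\hat{h}^+_\phi+\hat{h}^-_\phi$. The map $\phi$ has bad reduction at $v$ if some coefficient of $f$ has $|\cdot|_v>1$. Two polynomial maps $\phi_1,\phi_2:\mathbb{A}^2\to\mathbb{A}^2$ are affine conjugate if $\phi_2=\psi^{-1}\circ\phi_1\circ\psi$ for some $\psi(x,y)=(\alpha x+\beta y+s,\gamma x+\delta y+t)$ with coefficients in $\overline{K}$ and $\alpha\delta-\beta\gamma\neq0$.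 The constants of $\overline{K}$ are the elements $\eta\in\overline{K}$ with $|\eta|_w\le 1$ for every extension $w$ to $\overline{K}$ of every $v\in M_K$; $\phi$ is isotrivial if it is affine conjugate to a Hénon map all of whose coefficients are constants. A point $P$ is periodic if $\phi^n(P)=P$ for some $n\geq1$.
   Formalization: Bad reduction at v here also includes the case where the leading coefficient of f has absolute value < 1 at v; with the literal definition the uniform bound fails, e.g. for c²z³+ctz² (conjugates of z³+tz²) over growing finite extensions of k(t). *)

theory Defs
  imports Complex_Main "HOL-Computational_Algebra.Polynomial" "HOL-Algebra.Algebraic_Closure_Type"
begin

definition nonarch_abs :: "('a::field \<Rightarrow> real) \<Rightarrow> bool" where
  "nonarch_abs v \<longleftrightarrow>
     (\<forall>x. 0 \<le> v x) \<and> (\<forall>x. v x = 0 \<longleftrightarrow> x = 0) \<and>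
     (\<forall>x y. v (x * y) = v x * v y) \<and> (\<forall>x y. v (x + y) \<le> max (v x) (v y))"

text \<open>
  A function field is a field (the type) with its set \<open>M\<close> of absolute values. The product in the
  product formula is over the finitely many places where the factor differs from 1.
\<close>
definition function_field :: "('a::field \<Rightarrow> real) set \<Rightarrow> bool" where
  "function_field M \<longleftrightarrow>
     (\<forall>v\<in>M. nonarch_abs v \<and> (\<exists>x. x \<noteq> 0 \<and> v x \<noteq> 1)) \<and>
     (\<forall>x. x \<noteq> 0 \<longrightarrow> finite {v\<in>M. v x \<noteq> 1}) \<and>
     (\<forall>x. x \<noteq> 0 \<longrightarrow> (\<Prod>v | v \<in> M \<and> v x \<noteq> 1. v x) = 1)"

definition extends_abs :: "('a::field alg_closure \<Rightarrow> real) \<Rightarrow> ('a \<Rightarrow> real) \<Rightarrow> bool" where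
  "extends_abs w v \<longleftrightarrow> nonarch_abs w \<and> (\<forall>x. w (to_ac x) = v x)"

definition constants :: "('a::field \<Rightarrow> real) set \<Rightarrow> 'a alg_closure set" where
  "constants M = {\<eta>. \<forall>v\<in>M. \<forall>w. extends_abs w v \<longrightarrow> w \<eta> \<le> 1}"

text \<open>The sum is over the finitely many places with a nonzero contribution.\<close>
definition height :: "('a::field \<Rightarrow> real) set \<Rightarrow> 'a \<times> 'a \<Rightarrow> real" where
  "height M P = (\<Sum>v | v \<in> M \<and> max 1 (max (v (fst P)) (v (snd P))) \<noteq> 1.
                   ln (max 1 (max (v (fst P)) (v (snd P)))))"

text \<open>
  The general Henon map \<open>(x, y) \<mapsto> (a y, x + f(y))\<close>; the maps under study have \<open>a = 1\<close>.
\<close>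
definition henon :: "'b::field \<Rightarrow> 'b poly \<Rightarrow> 'b \<times> 'b \<Rightarrow> 'b \<times> 'b" where
  "henon a f P = (a * snd P, fst P + poly f (snd P))"

definition canonical_height_plus :: "('a::field \<Rightarrow> real) set \<Rightarrow> 'a poly \<Rightarrow> 'a \<times> 'a \<Rightarrow> real" where
  "canonical_height_plus M f P =
     lim (\<lambda>N. height M ((henon 1 f ^^ N) P) / real (degree f) ^ N)"

definition canonical_height_minus :: "('a::field \<Rightarrow> real) set \<Rightarrow> 'a poly \<Rightarrow> 'a \<times> 'a \<Rightarrow> real" where
  "canonical_height_minus M f P =
     lim (\<lambda>N. height M ((inv_into UNIV (henon 1 f) ^^ N) P) / real (degree f) ^ N)"

definition canonical_height :: "('a::field \<Rightarrow> real) set \<Rightarrow> 'a poly \<Rightarrow> 'a \<times> 'a \<Rightarrow> real" where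
  "canonical_height M f P = canonical_height_plus M f P + canonical_height_minus M f P"

definition periodic :: "('p \<Rightarrow> 'p) \<Rightarrow> 'p \<Rightarrow> bool" where
  "periodic \<phi> P \<longleftrightarrow> (\<exists>n\<ge>1. (\<phi> ^^ n) P = P)"

definition affine_map :: "'b::field \<Rightarrow> 'b \<Rightarrow> 'b \<Rightarrow> 'b \<Rightarrow> 'b \<Rightarrow> 'b \<Rightarrow> 'b \<times> 'b \<Rightarrow> 'b \<times> 'b" where
  "affine_map \<alpha> \<beta> s \<gamma> \<delta> t P =
     (\<alpha> * fst P + \<beta> * snd P + s, \<gamma> * fst P + \<delta> * snd P + t)"

text \<open>
  Used over an algebraically closed, hence infinite, field, where polynomial maps may be identified
  with the functions they induce.
\<close>
definition affine_conjugate :: "('b::field \<times> 'b \<Rightarrow> 'b \<times> 'b) \<Rightarrow> ('b \<times> 'b \<Rightarrow> 'b \<times> 'b) \<Rightarrow> bool" where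
  "affine_conjugate \<phi>\<^sub>1 \<phi>\<^sub>2 \<longleftrightarrow>
     (\<exists>\<alpha> \<beta> s \<gamma> \<delta> t. \<alpha> * \<delta> - \<beta> * \<gamma> \<noteq> 0 \<and>
        \<phi>\<^sub>2 = inv_into UNIV (affine_map \<alpha> \<beta> s \<gamma> \<delta> t) \<circ> \<phi>\<^sub>1 \<circ> affine_map \<alpha> \<beta> s \<gamma> \<delta> t)"

definition isotrivial :: "('a::field \<Rightarrow> real) set \<Rightarrow> 'a poly \<Rightarrow> bool" where
  "isotrivial M f \<longleftrightarrow>
     (\<exists>a g. a \<noteq> 0 \<and> 2 \<le> degree g \<and> a \<in> constants M \<and> (\<forall>i. coeff g i \<in> constants M) \<and>
        affine_conjugate (henon 1 (map_poly to_ac f)) (henon a g))"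

text \<open>
  The second disjunct, vacuous for monic \<open>f\<close>, says that an integral \<open>f\<close> drops in degree modulo
  \<open>v\<close>. Without it no bound in terms of \<open>d\<close> and the number of bad places exists: let \<open>k\<close> be an
  algebraically closed field of characteristic 0, \<open>L\<close> a finite extension of \<open>k(t)\<close>, and
  \<open>c \<in> L\<close> with a single pole, at a pole of \<open>t\<close>, vanishing to high order at the other poles of
  \<open>t\<close>. The map of the non-isotrivial \<open>z\<^sup>3 + t z\<^sup>2\<close> is conjugate over \<open>L\<close>, by scaling both
  coordinates by \<open>c\<close>, to the map of \<open>c\<^sup>2 z\<^sup>3 + c t z\<^sup>2\<close>, which has a coefficient with
  \<open>v (coeff f i) > 1\<close> at one place only. As \<open>L\<close> grows, the number of its periodic points over
  \<open>L\<close> is unbounded.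
\<close>
definition bad_reduction :: "('a::field \<Rightarrow> real) \<Rightarrow> 'a poly \<Rightarrow> bool" where
  "bad_reduction v f \<longleftrightarrow> (\<exists>i. v (coeff f i) > 1) \<or> v (lead_coeff f) < 1"

text \<open>
  An existential quantifier over the bound would let it depend on the field, which is a type here.
  A fixed function of the degree and the number of bad places is uniform in the field; it is not
  meant to be sharp.
\<close>
definition zero_height_bound :: "nat \<Rightarrow> nat \<Rightarrow> nat" where
  "zero_height_bound d s = (4 * d) ^ (4 * (s + 1))"

end

theory Submission
  imports Defs
begin

text \<open>
  A point of canonical height zero has both its forward and its backward orbit bounded at every
  place. Let \<open>X\<close> be the set of coordinates of such points; since the orbit satisfies
  \<open>f (z\<^sub>n) = z\<^sub>n\<^sub>+\<^sub>1 - z\<^sub>n\<^sub>-\<^sub>1\<close>, one has \<open>f (X) \<subseteq> X - X\<close>. With \<open>a\<close> the leading coefficient of \<open>f\<close>, write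
  \<open>x \<sim> y\<close> at \<open>v\<close> if \<open>v (a (x - y) ^ (d - 1)) \<le> 1\<close>. Lagrange interpolation at \<open>d + 1\<close> points
  shows that \<open>X\<close> meets at most \<open>d\<close> classes of this relation at any place, and a single one at a
  place of good reduction. If \<open>f\<close> is not isotrivial, then for some place the roots of \<open>f\<close> lie in
  different classes; there the classes of \<open>x\<close> and of its two neighbours in the orbit, together with
  one of at most \<open>d - 1\<close> further choices, confine \<open>x\<close> to a class of the strict relation with
  \<open>< 1\<close>. By the product formula, \<open>x\<close> is determined by its classes at the bad places, so
  \<open>X\<close> has at most \<open>d ^ (s + 3)\<close> elements. Only this one place has to be extended to
  the algebraic closure.
\<close>

subsection \<open>Non-archimedean absolute values\<close>

lemma nonarch_abs_nonneg: "nonarch_abs v \<Longrightarrow> 0 \<le> v x"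
  and nonarch_abs_eq_0: "nonarch_abs v \<Longrightarrow> v x = 0 \<longleftrightarrow> x = 0"
  and nonarch_abs_mult: "nonarch_abs v \<Longrightarrow> v (x * y) = v x * v y"
  and nonarch_abs_add: "nonarch_abs v \<Longrightarrow> v (x + y) \<le> max (v x) (v y)"
  by (auto simp: nonarch_abs_def)

lemma nonarch_abs_0: "nonarch_abs v \<Longrightarrow> v 0 = 0"
  by (simp add: nonarch_abs_eq_0)

lemma nonarch_abs_pos: "nonarch_abs v \<Longrightarrow> x \<noteq> 0 \<Longrightarrow> 0 < v x"
  by (metis nonarch_abs_eq_0 nonarch_abs_nonneg less_eq_real_def)

lemma nonarch_abs_1: "nonarch_abs v \<Longrightarrow> v 1 = 1"
  using nonarch_abs_mult[of v 1 1] nonarch_abs_pos[of v 1] by simp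

lemma nonarch_abs_minus:
  assumes "nonarch_abs v" shows "v (- x) = v x"
proof -
  have "v (-1) * v (-1) = 1"
    using nonarch_abs_mult[OF assms, of "-1" "-1"] nonarch_abs_1[OF assms] by simp
  then have "v (-1) = 1"
    using nonarch_abs_nonneg[OF assms, of "-1"] by (auto simp: square_eq_1_iff)
  then show ?thesis using nonarch_abs_mult[OF assms, of "-1" x] by simp
qed

lemma nonarch_abs_diff: "nonarch_abs v \<Longrightarrow> v (x - y) \<le> max (v x) (v y)"
  using nonarch_abs_add[of v x "- y"] nonarch_abs_minus[of v y] by simp

lemma nonarch_abs_commute: "nonarch_abs v \<Longrightarrow> v (x - y) = v (y - x)"
  using nonarch_abs_minus[of v "x - y"] by simp

lemma nonarch_abs_triangle: "nonarch_abs v \<Longrightarrow> v (x - z) \<le> max (v (x - y)) (v (y - z))"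
  using nonarch_abs_add[of v "x - y" "y - z"] by simp

lemma nonarch_abs_power: "nonarch_abs v \<Longrightarrow> v (x ^ n) = v x ^ n"
  by (induction n) (auto simp: nonarch_abs_1 nonarch_abs_mult)

lemma nonarch_abs_prod: "nonarch_abs v \<Longrightarrow> v (\<Prod>i\<in>A. g i) = (\<Prod>i\<in>A. v (g i))"
  by (induction A rule: infinite_finite_induct) (auto simp: nonarch_abs_1 nonarch_abs_mult)

lemma nonarch_abs_divide:
  assumes "nonarch_abs v" shows "v (x / y) = v x / v y"
proof (cases "y = 0")
  case False
  then have "v (x / y) * v y = v x" using nonarch_abs_mult[OF assms, of "x / y" y] by simp
  then show ?thesis using nonarch_abs_pos[OF assms False] by (simp add: field_simps)
qed (use assms in \<open>simp add: nonarch_abs_0\<close>)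

lemma nonarch_abs_sum_le:
  assumes "nonarch_abs v" "\<And>i. i \<in> A \<Longrightarrow> v (g i) \<le> B" "0 \<le> B"
  shows "v (\<Sum>i\<in>A. g i) \<le> B"
  using assms(2)
proof (induction A rule: infinite_finite_induct)
  case (insert a A)
  then show ?case using nonarch_abs_add[OF assms(1), of "g a" "sum g A"] insert.prems[of a] by fastforce
qed (use assms in \<open>auto simp: nonarch_abs_0\<close>)

lemma nonarch_abs_add_dominant:
  assumes "nonarch_abs v" "v y < v x"
  shows "v (x + y) = v x"
  using nonarch_abs_add[OF assms(1), of x y] nonarch_abs_diff[OF assms(1), of "x + y" y] assms(2)
  by auto

subsection \<open>Lagrange interpolation\<close>

text \<open>The interpolation polynomial \<open>q\<close> agrees with \<open>p\<close> at
  \<open>degree p + 1\<close> points and has degree at most \<open>degree p\<close>, so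
  \<open>q = p\<close>. Each basis polynomial \<open>w x\<close> is monic of degree
  \<open>degree p\<close>, hence the sum is the top coefficient of \<open>q\<close>.\<close>

lemma lagrange_lead_coeff:
  fixes p :: "'a::field poly"
  assumes "finite T" "card T = Suc (degree p)"
  shows "(\<Sum>x\<in>T. poly p x / (\<Prod>y\<in>T - {x}. x - y)) = lead_coeff p"
proof -
  define w where "w x = (\<Prod>y\<in>T - {x}. [:- y, 1:])" for x
  define q where "q = (\<Sum>x\<in>T. smult (poly p x / (\<Prod>y\<in>T - {x}. x - y)) (w x))"
  have degw: "degree (w x) = degree p" if "x \<in> T" for x
    unfolding w_def using assms that by (subst degree_prod_sum_eq) auto
  have lcw: "coeff (w x) (degree p) = 1" if "x \<in> T" for x
    using degw[OF that] lead_coeff_prod[of "\<lambda>y. [:- y, 1:]" "T - {x}"] unfolding w_def by simp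
  have "poly q z = poly p z" if "z \<in> T" for z
  proof -
    have 0: "poly (w x) z = 0" if "x \<in> T - {z}" for x
      using that \<open>z \<in> T\<close> assms(1) unfolding w_def poly_prod by (intro prod_zero) auto
    have nz: "(\<Prod>y\<in>T - {z}. z - y) \<noteq> 0" using assms(1) by auto
    have "poly q z = poly p z / (\<Prod>y\<in>T - {z}. z - y) * poly (w z) z"
      unfolding q_def poly_sum using \<open>z \<in> T\<close> assms(1) 0 by (subst sum.remove[of _ z]) auto
    also have "poly (w z) z = (\<Prod>y\<in>T - {z}. z - y)" by (simp add: w_def poly_prod)
    finally show ?thesis using nz by simp
  qed
  moreover have "degree q \<le> degree p"
    unfolding q_def using assms(1) degw by (intro degree_sum_le) (auto intro: order.trans[OF degree_smult_le])
  ultimately have "q = p"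
    using assms by (intro poly_eqI_degree[of T]) auto
  moreover have "coeff q (degree p) = (\<Sum>x\<in>T. poly p x / (\<Prod>y\<in>T - {x}. x - y))"
    unfolding q_def coeff_sum by (intro sum.cong) (auto simp: lcw)
  ultimately show ?thesis by simp
qed

text \<open>The leading coefficient is a sum of interpolation quotients, so by the ultrametric
  inequality one of them is at least as large. Subtracting a constant \<open>e\<close> from a
  nonconstant polynomial keeps its leading coefficient; below, \<open>e\<close> is 0 or a value of
  \<open>p\<close>.\<close>

lemma nonarch_lagrange:
  fixes p :: "'a::field poly"
  assumes v: "nonarch_abs v" and T: "finite T" "card T = Suc (degree p)" and "0 < degree p"
  shows "\<exists>x\<in>T. v (lead_coeff p) * (\<Prod>y\<in>T - {x}. v (x - y)) \<le> v (poly p x - e)"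
proof (rule ccontr)
  let ?q = "p - [:e:]"
  have deg: "degree ?q = degree p" using \<open>0 < degree p\<close>
    by (metis degree_pCons_0 degree_add_eq_left diff_conv_add_uminus degree_minus)
  have lc: "lead_coeff ?q = lead_coeff p" using \<open>0 < degree p\<close>
    by (simp add: deg coeff_pCons split: nat.split)
  assume "\<not> ?thesis"
  then have less: "v (poly p x - e) < v (lead_coeff p) * (\<Prod>y\<in>T - {x}. v (x - y))" if "x \<in> T" for x
    using that by (simp add: not_le)
  have "v (poly ?q x / (\<Prod>y\<in>T - {x}. x - y)) < v (lead_coeff p)" if "x \<in> T" for x
  proof -
    have "0 < (\<Prod>y\<in>T - {x}. v (x - y))" using nonarch_abs_pos[OF v] by (intro prod_pos) auto
    then show ?thesis using less[OF that]
      by (simp add: nonarch_abs_divide[OF v] nonarch_abs_prod[OF v] field_simps)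
  qed note * = this
  \<comment> \<open>The maximum turns the strict bounds on the finitely many terms into one bound
    \<open>B\<close> that is still strictly below \<open>v (lead_coeff p)\<close>.\<close>
  define B where "B = Max ((\<lambda>x. v (poly ?q x / (\<Prod>y\<in>T - {x}. x - y))) ` T)"
  have ne: "T \<noteq> {}" using T by auto
  have "B < v (lead_coeff p)" unfolding B_def using * T ne by (subst Max_less_iff) auto
  moreover have "v (\<Sum>x\<in>T. poly ?q x / (\<Prod>y\<in>T - {x}. x - y)) \<le> B"
  proof (rule nonarch_abs_sum_le[OF v])
    show le: "v (poly ?q x / (\<Prod>y\<in>T - {x}. x - y)) \<le> B" if "x \<in> T" for x
      unfolding B_def using that T by (intro Max_ge) auto
    show "0 \<le> B" using le ne nonarch_abs_nonneg[OF v] order.trans by (meson all_not_in_conv)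
  qed
  ultimately show False
    using lagrange_lead_coeff[OF T(1), of ?q] T(2) lc deg by simp
qed

subsection \<open>Classes of bounded orbits\<close>

text \<open>A maximal set \<open>S\<close> of pairwise unrelated elements has at most
  \<open>k\<close> members and meets every class; an element is coded by the number of its
  representative in \<open>S\<close>. Codes with values in a fixed range make it possible to combine
  and count classes at several places.\<close>

lemma equivalence_classes_code:
  assumes refl: "\<And>x. x \<in> Y \<Longrightarrow> r x x"
    and sym: "\<And>x y. x \<in> Y \<Longrightarrow> y \<in> Y \<Longrightarrow> r x y \<Longrightarrow> r y x"
    and trans: "\<And>x y z. x \<in> Y \<Longrightarrow> y \<in> Y \<Longrightarrow> z \<in> Y \<Longrightarrow> r x y \<Longrightarrow> r y z \<Longrightarrow> r x z"
    and few: "\<And>S. S \<subseteq> Y \<Longrightarrow> finite S \<Longrightarrow> card S = Suc k \<Longrightarrow> \<exists>x\<in>S. \<exists>y\<in>S. x \<noteq> y \<and> r x y"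
  shows "\<exists>\<kappa> :: 'a \<Rightarrow> nat. \<kappa> ` Y \<subseteq> {..<k} \<and> (\<forall>x\<in>Y. \<forall>y\<in>Y. \<kappa> x = \<kappa> y \<longrightarrow> r x y)"
proof -
  define P where "P S \<longleftrightarrow> S \<subseteq> Y \<and> finite S \<and> (\<forall>x\<in>S. \<forall>y\<in>S. x \<noteq> y \<longrightarrow> \<not> r x y)" for S
  have small: "card S \<le> k" if "P S" for S
  proof (rule ccontr)
    assume "\<not> card S \<le> k"
    then obtain S' where S': "S' \<subseteq> S" "card S' = Suc k" "finite S'"
      using obtain_subset_with_card_n[of "Suc k" S] by auto
    then show False using few[of S'] that unfolding P_def by blast
  qed
  have "P {}" by (simp add: P_def)
  moreover have "\<forall>S. P S \<longrightarrow> card S < Suc k" using small by (simp add: less_Suc_eq_le)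
  ultimately have "\<exists>S. P S \<and> (\<forall>S'. P S' \<longrightarrow> card S' \<le> card S)" by (rule ex_has_greatest_nat)
  then obtain S where S: "P S" and max: "\<And>S'. P S' \<Longrightarrow> card S' \<le> card S" by (elim exE conjE) simp
  have "\<exists>s\<in>S. r y s" if "y \<in> Y" for y
  proof (rule ccontr)
    assume *: "\<not> (\<exists>s\<in>S. r y s)"
    then have "y \<notin> S" using refl[OF that] by blast
    moreover have "P (insert y S)"
      using S that * sym unfolding P_def by (auto dest: subsetD)
    ultimately show False using max[of "insert y S"] S unfolding P_def by simp
  qed
  then obtain g where g: "\<And>y. y \<in> Y \<Longrightarrow> g y \<in> S \<and> r y (g y)" by metis
  obtain h where h: "bij_betw h S {0..<card S}"
    using ex_bij_betw_finite_nat[of S] S unfolding P_def by blast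
  have hS: "h s < card S" if "s \<in> S" for s using h that by (auto simp: bij_betw_def)
  have "(h \<circ> g) ` Y \<subseteq> {..<k}"
    using g hS small[OF S] by (fastforce intro: less_le_trans)
  moreover have "r x y" if "x \<in> Y" "y \<in> Y" "(h \<circ> g) x = (h \<circ> g) y" for x y
  proof -
    have "g x = g y" using h g that unfolding bij_betw_def by (auto dest: inj_onD)
    moreover have "g x \<in> Y" "g y \<in> Y" using g S that unfolding P_def by auto
    ultimately show ?thesis using g trans sym that by metis
  qed
  ultimately show ?thesis by blast
qed

lemma mult_power_less_cancel:
  fixes L s t :: real
  assumes "L * s ^ n < L * t ^ n" "0 \<le> L" "0 \<le> t"
  shows "s < t"
  using assms by (meson linorder_not_le mult_left_mono power_mono)

text \<open>Compared with 1, this gives transitivity of both the weak and the strict class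
  relation.\<close>

lemma scaled_nonarch_trans:
  assumes v: "nonarch_abs v" and L: "0 \<le> L"
  shows "L * v (x - z) ^ n \<le> max (L * v (x - y) ^ n) (L * v (y - z) ^ n)"
proof -
  have "v (x - z) \<le> v (x - y) \<or> v (x - z) \<le> v (y - z)"
    using nonarch_abs_triangle[OF v, of x z y] by auto
  then have "L * v (x - z) ^ n \<le> L * v (x - y) ^ n \<or> L * v (x - z) ^ n \<le> L * v (y - z) ^ n"
    using L nonarch_abs_nonneg[OF v] by (meson mult_left_mono power_mono)
  then show ?thesis by auto
qed

text \<open>Given \<open>d + 1\<close> points in different classes, with smallest distance
  \<open>m\<close>, two of them are exchanged for a pair \<open>a\<close>, \<open>b\<close> of
  almost maximal distance in \<open>Y\<close>. Interpolation at the new points yields a value of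
  \<open>p\<close> of size at least \<open>v (a - b) * L * m ^ (d - 1)\<close>, which exceeds the
  diameter of \<open>Y\<close>; but that value is a difference of elements of
  \<open>Y\<close>.\<close>

lemma nonarch_bounded_classes:
  fixes p :: "'a::field poly"
  assumes v: "nonarch_abs v" and deg: "2 \<le> degree p"
    and bdd: "\<And>y. y \<in> Y \<Longrightarrow> v y \<le> C"
    and dyn: "\<And>y. y \<in> Y \<Longrightarrow> \<exists>a\<in>Y. \<exists>b\<in>Y. poly p y = a - b"
  shows "\<exists>\<kappa> :: 'a \<Rightarrow> nat. \<kappa> ` Y \<subseteq> {..<degree p} \<and>
           (\<forall>x\<in>Y. \<forall>y\<in>Y. \<kappa> x = \<kappa> y \<longrightarrow> v (lead_coeff p) * v (x - y) ^ (degree p - 1) \<le> 1)"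
proof (rule equivalence_classes_code)
  let ?d = "degree p" and ?n = "degree p - 1"
  define L where "L = v (lead_coeff p)"
  have n: "0 < ?n" "?d = Suc ?n" using deg by auto
  have "p \<noteq> 0" using deg by auto
  then have L: "0 < L" unfolding L_def using nonarch_abs_pos[OF v] by simp
  show "v (lead_coeff p) * v (x - x) ^ ?n \<le> 1" for x
    using n nonarch_abs_0[OF v] by (simp add: power_0_left)
  show "v (lead_coeff p) * v (y - x) ^ ?n \<le> 1" if "v (lead_coeff p) * v (x - y) ^ ?n \<le> 1" for x y
    using that nonarch_abs_commute[OF v] by metis
  show "v (lead_coeff p) * v (x - z) ^ ?n \<le> 1"
    if "v (lead_coeff p) * v (x - y) ^ ?n \<le> 1" "v (lead_coeff p) * v (y - z) ^ ?n \<le> 1" for x y z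
    using that scaled_nonarch_trans[OF v less_imp_le[OF L], of x z ?n y] unfolding L_def by auto
  fix S assume S: "S \<subseteq> Y" "finite S" "card S = Suc ?d"
  show "\<exists>x\<in>S. \<exists>y\<in>S. x \<noteq> y \<and> v (lead_coeff p) * v (x - y) ^ ?n \<le> 1"
  proof (rule ccontr)
    assume "\<not> ?thesis"
    then have far: "1 < L * v (x - y) ^ ?n" if "x \<in> S" "y \<in> S" "x \<noteq> y" for x y
      using that unfolding L_def by force
    define W where "W = (\<lambda>(x, y). v (x - y)) ` {(x, y) \<in> S \<times> S. x \<noteq> y}"
    define m where "m = Min W"
    have "finite {(x, y) \<in> S \<times> S. x \<noteq> y}" by (rule finite_subset[of _ "S \<times> S"]) (use S in auto)
    then have finW: "finite W" unfolding W_def by simp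
    have "\<not> card S \<le> Suc 0" using S(3) deg by simp
    then obtain s1 s2 where "s1 \<in> S" "s2 \<in> S" "s1 \<noteq> s2"
      using card_le_Suc0_iff_eq[OF S(2)] by blast
    then have "v (s1 - s2) \<in> W" unfolding W_def by force
    then have "m \<in> W" unfolding m_def using finW by (intro Min_in) auto
    then obtain x0 y0 where x0: "x0 \<in> S" "y0 \<in> S" "x0 \<noteq> y0" "m = v (x0 - y0)"
      unfolding W_def by auto
    have mle: "m \<le> v (x - y)" if "x \<in> S" "y \<in> S" "x \<noteq> y" for x y
      unfolding m_def using that by (intro Min_le[OF finW]) (force simp: W_def)
    have m: "0 < m" using nonarch_abs_pos[OF v] x0 by simp
    \<comment> \<open>Points of \<open>S\<close> lie in different classes, so
      \<open>\<theta>\<close> exceeds 1; it is the margin by which the final estimate beats the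
      diameter.\<close>
    define \<theta> where "\<theta> = L * m ^ ?n"
    have \<theta>: "1 < \<theta>" unfolding \<theta>_def using far x0 by simp
    define V where "V = (\<lambda>(x, y). v (x - y)) ` (Y \<times> Y)"
    define D where "D = Sup V"
    have "v (x - y) \<le> C" if "x \<in> Y" "y \<in> Y" for x y
      using bdd[OF that(1)] bdd[OF that(2)] nonarch_abs_diff[OF v, of x y] by simp
    then have "bdd_above V" unfolding V_def by (intro bdd_aboveI[of _ C]) auto
    then have D: "v (x - y) \<le> D" if "x \<in> Y" "y \<in> Y" for x y
      unfolding D_def using that by (intro cSup_upper) (auto simp: V_def)
    \<comment> \<open>The supremum \<open>D\<close> need not be attained; a pair within the factor \<open>\<theta>\<close> of it suffices.\<close>
    have "\<exists>a\<in>Y. \<exists>b\<in>Y. m \<le> v (a - b) \<and> D < v (a - b) * \<theta>"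
    proof (cases "D < m * \<theta>")
      case True
      then show ?thesis using x0 S by blast
    next
      case False
      then have ge: "m \<le> D / \<theta>" using \<theta> by (simp add: field_simps)
      then have "0 < D / \<theta>" using m by simp
      then have "0 < D" using \<theta> by (simp add: zero_less_divide_iff)
      then have "D / \<theta> < D" using \<theta> by (simp add: field_simps)
      moreover have "V \<noteq> {}" using x0 S unfolding V_def by auto
      ultimately obtain z where "z \<in> V" "D / \<theta> < z" unfolding D_def using less_cSupD by metis
      then obtain a b where "a \<in> Y" "b \<in> Y" "D / \<theta> < v (a - b)" unfolding V_def by auto
      moreover from this have "m \<le> v (a - b)" using ge by linarith
      moreover have "D < v (a - b) * \<theta>"
        using \<open>D / \<theta> < v (a - b)\<close> \<theta> by (simp add: field_simps)
      ultimately show ?thesis by blast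
    qed
    then obtain a b where ab: "a \<in> Y" "b \<in> Y" "m \<le> v (a - b)" "D < v (a - b) * \<theta>" by blast
    \<comment> \<open>At most one point of \<open>S\<close> is near \<open>a\<close> and at most one near \<open>b\<close>; these are exchanged for \<open>a\<close> and \<open>b\<close>.\<close>
    define N where "N c = {x \<in> S. v (x - c) < m}" for c
    have N: "card (N c) \<le> 1" for c
    proof -
      have "x = y" if "x \<in> N c" "y \<in> N c" for x y
      proof (rule ccontr)
        assume "x \<noteq> y"
        then have "m \<le> v (x - y)" using mle that unfolding N_def by simp
        moreover have "v (x - y) < m"
          using nonarch_abs_triangle[OF v, of x y c] nonarch_abs_commute[OF v, of y c] that
          unfolding N_def by auto
        ultimately show False by simp
      qed
      then show ?thesis using S(2) by (auto simp: card_le_Suc0_iff_eq N_def)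
    qed
    have "card S - card (N a) \<le> card (S - N a)"
      using S by (intro diff_card_le_card_Diff) (auto simp: N_def)
    moreover have "card (S - N a) - card (N b) \<le> card (S - N a - N b)"
      using S by (intro diff_card_le_card_Diff) (auto simp: N_def)
    \<comment> \<open>Of the \<open>d + 1\<close> points of \<open>S\<close> at most two are lost;
      \<open>d - 1\<close> of the others together with \<open>a\<close> and \<open>b\<close> are
      again \<open>d + 1\<close> points.\<close>
    ultimately have "?n \<le> card (S - N a - N b)" using N[of a] N[of b] S(3) by linarith
    then obtain T' where T': "T' \<subseteq> S - N a - N b" "card T' = ?n" "finite T'"
      by (rule obtain_subset_with_card_n)
    have T'ab: "m \<le> v (x - a)" "m \<le> v (x - b)" if "x \<in> T'" for x
      using that T' unfolding N_def by auto
    have notin: "a \<notin> T'" "b \<notin> T'" "a \<noteq> b"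
      using T'ab[of a] T'ab[of b] ab(3) m nonarch_abs_0[OF v] by auto
    define T where "T = insert a (insert b T')"
    have TY: "T \<subseteq> Y" using T' S ab unfolding T_def by auto
    have T: "finite T" "card T = Suc ?d" using T' notin n(2) unfolding T_def by auto
    have mT: "m \<le> v (x - y)" if "x \<in> T" "y \<in> T" "x \<noteq> y" for x y
    proof -
      have "m \<le> v (x - y)" if "x \<in> T'" "y \<in> T'" "x \<noteq> y" for x y
        using that T' by (intro mle) auto
      then show ?thesis using that ab(3) T'ab nonarch_abs_commute[OF v] unfolding T_def by fastforce
    qed
    obtain x where x: "x \<in> T" "L * (\<Prod>y\<in>T - {x}. v (x - y)) \<le> v (poly p x - 0)"
      using nonarch_lagrange[OF v T, of 0] deg unfolding L_def by auto
    \<comment> \<open>Here the dynamics enters: a value of \<open>p\<close> on \<open>Y\<close> is a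
      difference of elements of \<open>Y\<close>, hence bounded by the diameter.\<close>
    have "v (poly p x) \<le> D" using dyn[of x] D x(1) TY by (metis subsetD)
    then have le: "L * (\<Prod>y\<in>T - {x}. v (x - y)) \<le> D" using x(2) by simp
    \<comment> \<open>By the ultrametric inequality \<open>x\<close> is at distance at least
      \<open>v (a - b)\<close> from \<open>a\<close> or from \<open>b\<close>. This factor is split
      off the product, and the other \<open>d - 1\<close> factors are bounded below by
      \<open>m\<close>.\<close>
    have "\<exists>z\<in>T. z \<noteq> x \<and> v (a - b) \<le> v (x - z)"
    proof (cases "x = a \<or> x = b")
      case True
      then show ?thesis using notin nonarch_abs_commute[OF v, of a b] unfolding T_def by auto
    next
      case False
      moreover have "v (a - b) \<le> v (x - a) \<or> v (a - b) \<le> v (x - b)"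
        using nonarch_abs_triangle[OF v, of a b x] nonarch_abs_commute[OF v, of a x] by auto
      ultimately show ?thesis unfolding T_def by auto
    qed
    then obtain z where z: "z \<in> T" "z \<noteq> x" "v (a - b) \<le> v (x - z)" by blast
    have "card (T - {x} - {z}) = ?n" using T x z n by simp
    then have "m ^ ?n = (\<Prod>y\<in>T - {x} - {z}. m)" by simp
    also have "\<dots> \<le> (\<Prod>y\<in>T - {x} - {z}. v (x - y))"
      using mT x(1) m by (intro prod_mono) auto
    finally have "v (a - b) * m ^ ?n \<le> v (x - z) * (\<Prod>y\<in>T - {x} - {z}. v (x - y))"
      using z m nonarch_abs_nonneg[OF v] by (intro mult_mono) auto
    also have "\<dots> = (\<Prod>y\<in>T - {x}. v (x - y))"
      using T z by (subst (2) prod.remove[of _ z]) auto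
    finally have "v (a - b) * \<theta> \<le> L * (\<Prod>y\<in>T - {x}. v (x - y))"
      unfolding \<theta>_def using L by (simp add: mult.left_commute)
    then show False using le ab(4) by simp
  qed
qed

text \<open>There are finitely many classes, and points in different classes are no farther apart
  than their representatives, so the largest distance between representatives is the diameter. The
  pair \<open>a\<close>, \<open>b\<close> ensures that distances within a class do not
  matter.\<close>

lemma nonarch_diameter_attained:
  assumes v: "nonarch_abs v" and L: "0 < L"
    and \<kappa>: "\<kappa> ` Y \<subseteq> {..<k::nat}" "\<And>x y. x \<in> Y \<Longrightarrow> y \<in> Y \<Longrightarrow> \<kappa> x = \<kappa> y \<Longrightarrow> L * v (x - y) ^ n \<le> 1"
    and Y: "a \<in> Y" "b \<in> Y" "1 < L * v (a - b) ^ n"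
  shows "\<exists>a\<in>Y. \<exists>b\<in>Y. \<forall>x\<in>Y. \<forall>y\<in>Y. v (x - y) \<le> v (a - b)"
proof -
  have "finite (\<kappa> ` Y)" using \<kappa>(1) finite_subset by blast
  define g where "g = inv_into Y \<kappa>"
  define R where "R = g ` \<kappa> ` Y"
  have R: "finite R" "R \<subseteq> Y" unfolding R_def g_def using \<open>finite (\<kappa> ` Y)\<close>
    by (auto simp: inv_into_into)
  have rep: "\<exists>r\<in>R. L * v (x - r) ^ n \<le> 1" if "x \<in> Y" for x
  proof
    show "g (\<kappa> x) \<in> R" unfolding R_def using that by blast
    then show "L * v (x - g (\<kappa> x)) ^ n \<le> 1"
      using R that by (intro \<kappa>(2)) (auto simp: g_def f_inv_into_f)
  qed
  define W where "W = (\<lambda>(x, y). v (x - y)) ` (R \<times> R)"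
  have W: "finite W" "W \<noteq> {}" using R rep[OF Y(1)] unfolding W_def by auto
  then have "Max W \<in> W" by simp
  then obtain r s where rs: "r \<in> R" "s \<in> R" "Max W = v (r - s)" unfolding W_def by auto
  have far: "v (x - y) \<le> v (r - s)" if xy: "x \<in> Y" "y \<in> Y" "1 < L * v (x - y) ^ n" for x y
  proof -
    obtain x' y' where x': "x' \<in> R" "L * v (x - x') ^ n \<le> 1" and y': "y' \<in> R" "L * v (y - y') ^ n \<le> 1"
      using rep xy by meson
    have "L * v (x - x') ^ n < L * v (x - y) ^ n" "L * v (y - y') ^ n < L * v (x - y) ^ n"
      using x' y' xy by linarith+
    then have "v (x - x') < v (x - y)" "v (y - y') < v (x - y)"
      using mult_power_less_cancel[OF _ less_imp_le[OF L] nonarch_abs_nonneg[OF v]] by blast+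
    then have "v (x - y) \<le> v (x' - y')"
      using nonarch_abs_triangle[OF v, of x y x'] nonarch_abs_triangle[OF v, of x' y y']
        nonarch_abs_commute[OF v, of y y'] by auto
    also have "\<dots> \<le> Max W" using x' y' W by (intro Max_ge) (auto simp: W_def)
    finally show ?thesis using rs by simp
  qed
  have "v (x - y) \<le> v (r - s)" if xy: "x \<in> Y" "y \<in> Y" for x y
  proof (cases "1 < L * v (x - y) ^ n")
    case False
    then have "L * v (x - y) ^ n < L * v (a - b) ^ n" using Y by linarith
    then have "v (x - y) < v (a - b)"
      using mult_power_less_cancel[OF _ less_imp_le[OF L] nonarch_abs_nonneg[OF v]] by blast
    then show ?thesis using far[OF Y] by simp
  qed (use far xy in blast)
  then show ?thesis using rs R by blast
qed

text \<open>If \<open>d\<close> points of \<open>U\<close> were in different strict classes,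
  interpolation at them and at a point \<open>y\<close> at distance \<open>D\<close>, relative to
  the value \<open>poly p u\<close>, would contradict \<open>far\<close> when the large quotient
  belongs to \<open>y\<close> and \<open>near_image\<close> when it belongs to a point of
  \<open>U\<close>. The extra point is what lowers the count from \<open>d\<close> to
  \<open>d - 1\<close>.\<close>

lemma nonarch_strict_subclasses:
  fixes p :: "'a::field poly"
  assumes v: "nonarch_abs v" and deg: "2 \<le> degree p"
    and near: "\<And>x y. x \<in> U \<Longrightarrow> y \<in> U \<Longrightarrow> v (lead_coeff p) * v (x - y) ^ (degree p - 1) \<le> 1"
    and near_image:
      "\<And>x y. x \<in> U \<Longrightarrow> y \<in> U \<Longrightarrow> v (lead_coeff p) * v (poly p x - poly p y) ^ (degree p - 1) \<le> 1"
    and far: "\<And>u. u \<in> U \<Longrightarrow> \<exists>y. v (u - y) = D \<and> v (poly p y - poly p u) \<le> D"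
    and D: "1 < v (lead_coeff p) * D ^ (degree p - 1)" "0 < D"
  shows "\<exists>\<mu> :: 'a \<Rightarrow> nat. \<mu> ` U \<subseteq> {..<degree p - 1} \<and>
           (\<forall>x\<in>U. \<forall>y\<in>U. \<mu> x = \<mu> y \<longrightarrow> v (lead_coeff p) * v (x - y) ^ (degree p - 1) < 1)"
proof (rule equivalence_classes_code)
  let ?d = "degree p" and ?n = "degree p - 1"
  define L where "L = v (lead_coeff p)"
  have n: "0 < ?n" "?d = Suc ?n" using deg by auto
  have "p \<noteq> 0" using deg by auto
  then have L: "0 < L" unfolding L_def using nonarch_abs_pos[OF v] by simp
  show "v (lead_coeff p) * v (x - x) ^ ?n < 1" for x
    using n nonarch_abs_0[OF v] by (simp add: power_0_left)
  show "v (lead_coeff p) * v (y - x) ^ ?n < 1" if "v (lead_coeff p) * v (x - y) ^ ?n < 1" for x y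
    using that nonarch_abs_commute[OF v] by metis
  show "v (lead_coeff p) * v (x - z) ^ ?n < 1"
    if "v (lead_coeff p) * v (x - y) ^ ?n < 1" "v (lead_coeff p) * v (y - z) ^ ?n < 1" for x y z
    using that scaled_nonarch_trans[OF v less_imp_le[OF L], of x z ?n y] unfolding L_def by auto
  fix S assume S: "S \<subseteq> U" "finite S" "card S = Suc ?n"
  show "\<exists>x\<in>S. \<exists>y\<in>S. x \<noteq> y \<and> v (lead_coeff p) * v (x - y) ^ ?n < 1"
  proof (rule ccontr)
    assume "\<not> ?thesis"
    then have ge: "1 \<le> L * v (x - y) ^ ?n" if "x \<in> S" "y \<in> S" "x \<noteq> y" for x y
      using that unfolding L_def by force
    obtain u where u: "u \<in> S" using S(3) by fastforce
    then obtain y where y: "v (u - y) = D" "v (poly p y - poly p u) \<le> D" using far S by blast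
    \<comment> \<open>All of \<open>S\<close> lies in one weak class, whose diameter is smaller than
      \<open>D\<close>, so \<open>y\<close> is equally far from all points of
      \<open>S\<close>.\<close>
    have yD: "v (x - y) = D" if "x \<in> S" for x
    proof -
      have "L * v (x - u) ^ ?n \<le> 1" using near S u that unfolding L_def by blast
      then have "L * v (x - u) ^ ?n < L * D ^ ?n" using D(1) unfolding L_def by linarith
      then have "v (x - u) < v (u - y)"
        using mult_power_less_cancel[of L _ ?n D] D(2) L y(1) by simp
      then show ?thesis using nonarch_abs_add_dominant[OF v, of "x - u" "u - y"] y(1) by (simp add: add.commute)
    qed
    then have "y \<notin> S" using nonarch_abs_0[OF v] D(2) by force
    \<comment> \<open>Interpolating at \<open>y\<close> as well gives the factor \<open>D\<close> that makes the estimate strict.\<close>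
    define T where "T = insert y S"
    have T: "finite T" "card T = Suc ?d" using S \<open>y \<notin> S\<close> n unfolding T_def by auto
    obtain x where x: "x \<in> T" "L * (\<Prod>z\<in>T - {x}. v (x - z)) \<le> v (poly p x - poly p u)"
      using nonarch_lagrange[OF v T, of "poly p u"] deg unfolding L_def by auto
    show False
    proof (cases "x = y")
      case True
      have "(\<Prod>z\<in>T - {x}. v (x - z)) = (\<Prod>z\<in>S. D)"
        using yD nonarch_abs_commute[OF v] \<open>y \<notin> S\<close> unfolding T_def True by (intro prod.cong) auto
      also have "\<dots> = D * D ^ ?n" using S(3) by simp
      finally have "D * (L * D ^ ?n) \<le> D * 1" using x(2) y(2) True by (simp add: mult.left_commute)
      then show False using D unfolding L_def by (simp only: mult_le_cancel_left_pos)
    next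
      case False
      then have xS: "x \<in> S" using x(1) unfolding T_def by simp
      define Q where "Q = (\<Prod>z\<in>S - {x}. v (x - z))"
      define E where "E = v (poly p x - poly p u)"
      have "T - {x} = insert y (S - {x})" using False unfolding T_def by auto
      then have "(\<Prod>z\<in>T - {x}. v (x - z)) = D * Q"
        using S(2) \<open>y \<notin> S\<close> yD[OF xS] unfolding Q_def by simp
      then have "L * (D * Q) \<le> E" using x(2) unfolding E_def by simp
      moreover have "0 \<le> Q" unfolding Q_def using nonarch_abs_nonneg[OF v] by (simp add: prod_nonneg)
      \<comment> \<open>Raising to the power \<open>d - 1\<close> produces one factor
        \<open>L\<close> for each of the \<open>d - 1\<close> points of \<open>S - {x}\<close>,
        matching the form in which the distances are bounded below by \<open>ge\<close>.\<close>
      ultimately have "(L * (D * Q)) ^ ?n \<le> E ^ ?n" using L D by (intro power_mono) auto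
      then have "L * (L * (D * Q)) ^ ?n \<le> L * E ^ ?n" using L by simp
      also have "\<dots> \<le> 1" unfolding L_def E_def using near_image S xS u by blast
      finally have le: "(L * D ^ ?n) * (L ^ ?n * Q ^ ?n) \<le> 1"
        by (simp add: power_mult_distrib mult_ac)
      have "card (S - {x}) = ?n" using S xS by simp
      then have "L ^ ?n * Q ^ ?n = (\<Prod>z\<in>S - {x}. L * v (x - z) ^ ?n)"
        unfolding Q_def by (simp add: prod.distrib prod_power_distrib)
      also have "1 \<le> \<dots>" using ge xS by (intro prod_ge_1) auto
      finally have "L * D ^ ?n \<le> (L * D ^ ?n) * (L ^ ?n * Q ^ ?n)"
        using mult_left_mono[of 1 "L ^ ?n * Q ^ ?n" "L * D ^ ?n"] L D by simp
      then show False using le D unfolding L_def by simp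
    qed
  qed
qed

text \<open>Writing \<open>poly p y = g y - h y\<close>, the weak classes of \<open>y\<close>,
  \<open>g y\<close> and \<open>h y\<close> fix the weak class of \<open>poly p y\<close> as well.
  On each set with a common triple \<open>nonarch_strict_subclasses\<close> applies,
  \<open>D\<close> being the diameter of \<open>Y\<close>; the number of the strict subclass is the
  fourth component of the code.\<close>

lemma nonarch_bounded_strict_classes:
  fixes p :: "'a::field poly"
  assumes v: "nonarch_abs v" and deg: "2 \<le> degree p"
    and bdd: "\<And>y. y \<in> Y \<Longrightarrow> v y \<le> C"
    and dyn: "\<And>y. y \<in> Y \<Longrightarrow> \<exists>a\<in>Y. \<exists>b\<in>Y. poly p y = a - b"
    and spread: "a \<in> Y" "b \<in> Y" "1 < v (lead_coeff p) * v (a - b) ^ (degree p - 1)"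
  shows "\<exists>\<kappa> :: 'a \<Rightarrow> nat \<times> nat \<times> nat \<times> nat.
           \<kappa> ` Y \<subseteq> {..<degree p} \<times> {..<degree p} \<times> {..<degree p} \<times> {..<degree p} \<and>
           (\<forall>x\<in>Y. \<forall>y\<in>Y. \<kappa> x = \<kappa> y \<longrightarrow> v (lead_coeff p) * v (x - y) ^ (degree p - 1) < 1)"
proof -
  let ?d = "degree p" and ?n = "degree p - 1"
  define L where "L = v (lead_coeff p)"
  have n: "0 < ?n" using deg by auto
  have "p \<noteq> 0" using deg by auto
  then have L: "0 < L" unfolding L_def using nonarch_abs_pos[OF v] by simp
  obtain \<kappa> :: "'a \<Rightarrow> nat" where \<kappa>: "\<kappa> ` Y \<subseteq> {..<?d}"
    "\<And>x y. x \<in> Y \<Longrightarrow> y \<in> Y \<Longrightarrow> \<kappa> x = \<kappa> y \<Longrightarrow> L * v (x - y) ^ ?n \<le> 1"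
    using nonarch_bounded_classes[OF v deg bdd dyn] unfolding L_def by blast
  obtain r s where rs: "r \<in> Y" "s \<in> Y" and diam: "\<And>x y. x \<in> Y \<Longrightarrow> y \<in> Y \<Longrightarrow> v (x - y) \<le> v (r - s)"
    using nonarch_diameter_attained[OF v L \<kappa> spread[folded L_def]] by blast
  define D where "D = v (r - s)"
  have "L * v (a - b) ^ ?n \<le> L * D ^ ?n"
    using diam spread L nonarch_abs_nonneg[OF v] unfolding D_def by (intro mult_left_mono power_mono) auto
  then have D1: "1 < L * D ^ ?n" using spread unfolding L_def by simp
  moreover have "0 \<le> D" unfolding D_def by (rule nonarch_abs_nonneg[OF v])
  ultimately have D0: "0 < D" using n by (cases "D = 0") (auto simp: power_0_left)
  obtain g h where gh: "\<And>y. y \<in> Y \<Longrightarrow> g y \<in> Y \<and> h y \<in> Y \<and> poly p y = g y - h y"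
    using dyn by metis
  define c where "c y = (\<kappa> y, \<kappa> (g y), \<kappa> (h y))" for y
  have "\<exists>\<mu> :: 'a \<Rightarrow> nat. \<mu> ` {y \<in> Y. c y = i} \<subseteq> {..<?n} \<and>
     (\<forall>x\<in>{y \<in> Y. c y = i}. \<forall>y\<in>{y \<in> Y. c y = i}. \<mu> x = \<mu> y \<longrightarrow> L * v (x - y) ^ ?n < 1)" for i
    unfolding L_def
  proof (rule nonarch_strict_subclasses[OF v deg, where D = D])
    show "1 < v (lead_coeff p) * D ^ ?n" using D1 unfolding L_def .
    fix u assume u: "u \<in> {y \<in> Y. c y = i}"
    have "v (poly p y - poly p u) \<le> D" if "y \<in> Y" for y
    proof -
      \<comment> \<open>Both differences in brackets are at most the diameter, hence so is the
        difference of two values of \<open>p\<close>.\<close>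
      have "poly p y - poly p u = (g y - h y) - (g u - h u)" using gh u that by simp
      then show ?thesis
        using nonarch_abs_diff[OF v, of "g y - h y" "g u - h u"] diam[of "g y" "h y"] diam[of "g u" "h u"] gh u that
        unfolding D_def by auto
    qed
    moreover have "\<exists>y\<in>Y. v (u - y) = D"
    proof -
      \<comment> \<open>For an ultrametric, every point is at maximal distance from one end of a
        pair that realizes the diameter.\<close>
      have "v (u - r) = D \<or> v (u - s) = D"
        using nonarch_abs_triangle[OF v, of r s u] nonarch_abs_commute[OF v, of r u]
          diam[of u r] diam[of u s] rs u unfolding D_def by auto
      then show ?thesis using rs by blast
    qed
    ultimately show "\<exists>y. v (u - y) = D \<and> v (poly p y - poly p u) \<le> D" by blast
  next
    fix x y assume xy: "x \<in> {y \<in> Y. c y = i}" "y \<in> {y \<in> Y. c y = i}"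
    then show "v (lead_coeff p) * v (x - y) ^ ?n \<le> 1" using \<kappa>(2) unfolding c_def L_def by auto
    have "poly p x - poly p y = (g x - g y) - (h x - h y)" using gh xy by simp
    moreover have "\<kappa> (g x) = \<kappa> (g y)" "\<kappa> (h x) = \<kappa> (h y)" using xy by (auto simp: c_def)
    then have "L * v (g x - g y) ^ ?n \<le> 1" "L * v (h x - h y) ^ ?n \<le> 1"
      using xy gh \<kappa>(2) by simp_all
    ultimately show "v (lead_coeff p) * v (poly p x - poly p y) ^ ?n \<le> 1"
      using scaled_nonarch_trans[OF v less_imp_le[OF L], of "g x - g y" "h x - h y" ?n 0] nonarch_abs_minus[OF v, of "h x - h y"]
      unfolding L_def by auto
  qed (use D0 in auto)
  then have "\<forall>i. \<exists>\<mu> :: 'a \<Rightarrow> nat. \<mu> ` {y \<in> Y. c y = i} \<subseteq> {..<?n} \<and>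
     (\<forall>x\<in>{y \<in> Y. c y = i}. \<forall>y\<in>{y \<in> Y. c y = i}. \<mu> x = \<mu> y \<longrightarrow> L * v (x - y) ^ ?n < 1)" ..
  from choice[OF this] obtain \<mu> :: "nat \<times> nat \<times> nat \<Rightarrow> 'a \<Rightarrow> nat" where
    \<mu>: "\<And>i. \<mu> i ` {y \<in> Y. c y = i} \<subseteq> {..<?n}"
      "\<And>i x y. x \<in> Y \<Longrightarrow> c x = i \<Longrightarrow> y \<in> Y \<Longrightarrow> c y = i \<Longrightarrow> \<mu> i x = \<mu> i y \<Longrightarrow> L * v (x - y) ^ ?n < 1"
    by blast
  have "\<mu> (c y) y < ?n" if "y \<in> Y" for y using \<mu>(1)[of "c y"] that by auto
  then have "(\<lambda>y. (\<mu> (c y) y, c y)) ` Y \<subseteq> {..<?d} \<times> {..<?d} \<times> {..<?d} \<times> {..<?d}"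
    using \<kappa>(1) gh by (fastforce simp: c_def)
  moreover have "\<forall>x\<in>Y. \<forall>y\<in>Y. (\<mu> (c x) x, c x) = (\<mu> (c y) y, c y) \<longrightarrow> L * v (x - y) ^ ?n < 1"
    using \<mu>(2) by (metis Pair_inject)
  ultimately show ?thesis unfolding L_def by (intro exI[of _ "\<lambda>y. (\<mu> (c y) y, c y)"]) simp
qed

subsection \<open>Canonical heights\<close>

lemma function_field_nonarch: "function_field M \<Longrightarrow> v \<in> M \<Longrightarrow> nonarch_abs v"
  by (simp add: function_field_def)

lemma function_field_finite: "function_field M \<Longrightarrow> finite {v \<in> M. x \<noteq> 0 \<and> v x \<noteq> 1}"
  by (cases "x = 0") (auto simp: function_field_def)

definition local_max :: "('a::field \<Rightarrow> real) \<Rightarrow> 'a \<times> 'a \<Rightarrow> real" where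
  "local_max v P = max 1 (max (v (fst P)) (v (snd P)))"

lemma local_max_ge: "1 \<le> local_max v P" "v (fst P) \<le> local_max v P" "v (snd P) \<le> local_max v P"
  by (auto simp: local_max_def)

lemma height_local_max: "height M P = (\<Sum>v | v \<in> M \<and> local_max v P \<noteq> 1. ln (local_max v P))"
  by (simp add: height_def local_max_def)

lemma finite_local_max:
  assumes "function_field M"
  shows "finite {v \<in> M. local_max v P \<noteq> 1}"
proof (rule finite_subset)
  show "{v \<in> M. local_max v P \<noteq> 1} \<subseteq>
    {v \<in> M. fst P \<noteq> 0 \<and> v (fst P) \<noteq> 1} \<union> {v \<in> M. snd P \<noteq> 0 \<and> v (snd P) \<noteq> 1}"
    using function_field_nonarch[OF assms] by (auto simp: local_max_def nonarch_abs_0)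
qed (use assms function_field_finite in blast)

text \<open>One finite set \<open>S\<close> can serve several points, so that their heights can be
  compared place by place.\<close>

lemma height_eq_sum:
  assumes "finite S" "{v \<in> M. local_max v P \<noteq> 1} \<subseteq> S" "S \<subseteq> M"
  shows "height M P = (\<Sum>v\<in>S. ln (local_max v P))"
  unfolding height_local_max using assms by (intro sum.mono_neutral_left) auto

lemma height_ge_local:
  assumes "function_field M" "v \<in> M"
  shows "ln (local_max v P) \<le> height M P"
proof -
  have "height M P = (\<Sum>v\<in>insert v {v \<in> M. local_max v P \<noteq> 1}. ln (local_max v P))"
    using assms finite_local_max[OF assms(1), of P] by (intro height_eq_sum) auto
  also have "\<dots> \<ge> ln (local_max v P)"
    using assms finite_local_max[OF assms(1), of P] by (intro member_le_sum) (auto simp: local_max_ge)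
  finally show ?thesis .
qed

lemma height_nonneg: "0 \<le> height M P"
  unfolding height_local_max by (intro sum_nonneg) (simp add: local_max_ge)

lemma height_swap: "height M (prod.swap P) = height M P"
  by (simp add: height_def max.commute)

section \<open>Growth of the height under one step of the map\<close>

lemma nonarch_poly_le:
  assumes v: "nonarch_abs v" and B: "\<And>i. v (coeff p i) \<le> B" and m: "1 \<le> m" "v y \<le> m"
  shows "v (poly p y) \<le> B * m ^ degree p"
  unfolding poly_altdef
proof (rule nonarch_abs_sum_le[OF v])
  have B0: "0 \<le> B" using B[of 0] nonarch_abs_nonneg[OF v] order.trans by blast
  then show "0 \<le> B * m ^ degree p" using m by simp
  fix i assume "i \<in> {..degree p}"
  then have "v y ^ i \<le> m ^ i" "m ^ i \<le> m ^ degree p"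
    using m nonarch_abs_nonneg[OF v] by (auto intro: power_mono power_increasing)
  then show "v (coeff p i * y ^ i) \<le> B * m ^ degree p"
    unfolding nonarch_abs_mult[OF v] nonarch_abs_power[OF v]
    using B[of i] B0 nonarch_abs_nonneg[OF v] by (intro mult_mono) auto
qed

text \<open>The 1 in the maximum keeps the logarithm nonnegative and makes the bound trivial at
  almost all places.\<close>

definition coeff_bound :: "('a::field \<Rightarrow> real) \<Rightarrow> 'a poly \<Rightarrow> real" where
  "coeff_bound v p = Max (insert 1 ((\<lambda>i. v (coeff p i)) ` {..degree p}))"

lemma coeff_bound:
  assumes "nonarch_abs v"
  shows "v (coeff p i) \<le> coeff_bound v p" "1 \<le> coeff_bound v p"
proof -
  show ge1: "1 \<le> coeff_bound v p" unfolding coeff_bound_def by (intro Max_ge) auto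
  show "v (coeff p i) \<le> coeff_bound v p"
  proof (cases "i \<le> degree p")
    case True
    then show ?thesis unfolding coeff_bound_def by (intro Max_ge) auto
  next
    case False
    then show ?thesis using ge1 by (simp add: coeff_eq_0 nonarch_abs_0[OF assms])
  qed
qed

lemma finite_coeff_bound:
  assumes "function_field M"
  shows "finite {v \<in> M. coeff_bound v p \<noteq> 1}"
proof (rule finite_subset)
  show "{v \<in> M. coeff_bound v p \<noteq> 1} \<subseteq> (\<Union>i\<le>degree p. {v \<in> M. coeff p i \<noteq> 0 \<and> v (coeff p i) \<noteq> 1})"
  proof clarify
    fix v assume v: "v \<in> M" "coeff_bound v p \<noteq> 1"
    then have "nonarch_abs v" using function_field_nonarch[OF assms] by blast
    then have "1 < coeff_bound v p" using v coeff_bound[of v p] by (simp add: less_eq_real_def)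
    then obtain i where "i \<le> degree p" "1 < v (coeff p i)"
      unfolding coeff_bound_def by (subst (asm) Max_gr_iff) auto
    then show "v \<in> (\<Union>i\<le>degree p. {v \<in> M. coeff p i \<noteq> 0 \<and> v (coeff p i) \<noteq> 1})"
      using v nonarch_abs_0[OF \<open>nonarch_abs v\<close>] by fastforce
  qed
qed (use function_field_finite[OF assms] in auto)

text \<open>At each place the local maximum grows at most to its \<open>d\<close>-th power times
  \<open>coeff_bound v f\<close>. The constant sums the logarithms of these bounds over the finitely
  many places where they differ from 1, independently of \<open>P\<close>.\<close>

lemma height_henon_le:
  assumes M: "function_field M" and deg: "0 < degree f"
  shows "\<exists>C\<ge>0. \<forall>P. height M (henon 1 f P) \<le> real (degree f) * height M P + C"
proof (intro exI conjI allI)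
  let ?A = "{v \<in> M. coeff_bound v f \<noteq> 1}"
  have na: "nonarch_abs v" if "v \<in> M" for v using function_field_nonarch[OF M that] .
  show "0 \<le> (\<Sum>v\<in>?A. ln (coeff_bound v f))"
    using na coeff_bound(2) by (intro sum_nonneg ln_ge_zero) blast
  fix P :: "'a \<times> 'a"
  let ?Q = "henon 1 f P"
  define S where "S = ?A \<union> {v \<in> M. local_max v P \<noteq> 1} \<union> {v \<in> M. local_max v ?Q \<noteq> 1}"
  have S: "finite S" "S \<subseteq> M" unfolding S_def using finite_local_max[OF M] finite_coeff_bound[OF M] by auto
  have local: "ln (local_max v ?Q) \<le> real (degree f) * ln (local_max v P) + ln (coeff_bound v f)" if "v \<in> S" for v
  proof -
    have v: "nonarch_abs v" using that S na by blast
    let ?m = "local_max v P" and ?B = "coeff_bound v f"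
    have B: "1 \<le> ?B" by (rule coeff_bound[OF v])
    have m: "1 \<le> ?m" by (rule local_max_ge)
    have "?m \<le> ?m ^ degree f" using m deg by (simp add: self_le_power)
    also have "1 * ?m ^ degree f \<le> ?B * ?m ^ degree f" using B m by (intro mult_right_mono) auto
    finally have le: "?m \<le> ?B * ?m ^ degree f" by simp
    moreover have "v (poly f (snd P)) \<le> ?B * ?m ^ degree f"
      by (intro nonarch_poly_le v coeff_bound local_max_ge)
    ultimately have "local_max v ?Q \<le> ?B * ?m ^ degree f"
      using nonarch_abs_add[OF v, of "fst P" "poly f (snd P)"] local_max_ge[of v P]
      unfolding local_max_def[of v ?Q] by (auto simp: henon_def)
    then have "ln (local_max v ?Q) \<le> ln (?B * ?m ^ degree f)"
      using local_max_ge(1)[of v ?Q] by (intro ln_mono) auto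
    also have "\<dots> = real (degree f) * ln ?m + ln ?B" using B m by (simp add: ln_mult ln_realpow)
    finally show ?thesis .
  qed
  have "height M ?Q = (\<Sum>v\<in>S. ln (local_max v ?Q))"
    using S by (intro height_eq_sum) (auto simp: S_def)
  also have "\<dots> \<le> (\<Sum>v\<in>S. real (degree f) * ln (local_max v P) + ln (coeff_bound v f))"
    by (intro sum_mono local)
  also have "\<dots> = real (degree f) * (\<Sum>v\<in>S. ln (local_max v P)) + (\<Sum>v\<in>S. ln (coeff_bound v f))"
    by (simp add: sum.distrib sum_distrib_left)
  also have "(\<Sum>v\<in>S. ln (local_max v P)) = height M P"
    using S by (intro height_eq_sum[symmetric]) (auto simp: S_def)
  also have "(\<Sum>v\<in>S. ln (coeff_bound v f)) = (\<Sum>v\<in>?A. ln (coeff_bound v f))"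
    using S by (intro sum.mono_neutral_right) (auto simp: S_def)
  finally show "height M ?Q \<le> real (degree f) * height M P + (\<Sum>v\<in>?A. ln (coeff_bound v f))" .
qed

section \<open>Existence and transformation rule of the canonical heights\<close>

lemma convergent_affine_growth:
  fixes h :: "nat \<Rightarrow> real"
  assumes step: "\<And>N. h (Suc N) \<le> d * h N + C" and nonneg: "\<And>N. 0 \<le> h N" and C: "0 \<le> C" and d: "1 < d"
  shows "convergent (\<lambda>N. h N / d ^ N)"
proof -
  \<comment> \<open>Without a lower bound for \<open>h (Suc N)\<close> telescoping fails, but adding \<open>c\<close> makes the sequence
    decreasing.\<close>
  define c where "c N = C / (d - 1) / d ^ N" for N
  define b where "b N = h N / d ^ N + c N" for N
  have "b (Suc N) \<le> b N" for N
  proof -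
    have "h (Suc N) / d ^ Suc N \<le> (d * h N + C) / d ^ Suc N"
      using step d by (intro divide_right_mono) auto
    \<comment> \<open>\<open>c N\<close> is the tail of the geometric series with terms
      \<open>C / d ^ k\<close> for \<open>k > N\<close>, so \<open>c N - c (Suc N)\<close> is
      exactly the error \<open>C / d ^ Suc N\<close> of this step.\<close>
    also have "\<dots> + c (Suc N) = h N / d ^ N + c N"
      using d unfolding c_def by (simp add: divide_simps) (simp add: algebra_simps)
    finally show ?thesis unfolding b_def by simp
  qed
  then have "decseq b" by (rule decseq_SucI)
  moreover have "0 \<le> b i" for i unfolding b_def c_def using nonneg C d by simp
  ultimately obtain l where "b \<longlonglongrightarrow> l" using decseq_convergent by blast
  moreover have "c \<longlonglongrightarrow> 0"
    unfolding c_def using d by (intro LIMSEQ_divide_realpow_zero)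
  ultimately have "(\<lambda>N. b N - c N) \<longlonglongrightarrow> l - 0" by (intro tendsto_diff)
  then show ?thesis unfolding b_def by (auto simp: convergent_def)
qed

text \<open>The definition through \<open>lim\<close> carries information only once convergence is
  known; the affine growth bound supplies it.\<close>

lemma canonical_height_plus_LIMSEQ:
  assumes M: "function_field M" and deg: "2 \<le> degree f"
  shows "(\<lambda>N. height M ((henon 1 f ^^ N) P) / real (degree f) ^ N) \<longlonglongrightarrow> canonical_height_plus M f P"
proof -
  obtain C where C: "0 \<le> C" "\<And>P. height M (henon 1 f P) \<le> real (degree f) * height M P + C"
    using height_henon_le[OF M, of f] deg by auto
  then have "convergent (\<lambda>N. height M ((henon 1 f ^^ N) P) / real (degree f) ^ N)"
    using deg by (intro convergent_affine_growth[of _ _ C]) (auto simp: height_nonneg)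
  then show ?thesis unfolding canonical_height_plus_def by (simp add: convergent_LIMSEQ_iff)
qed

lemma canonical_height_plus_nonneg:
  assumes "function_field M" "2 \<le> degree f"
  shows "0 \<le> canonical_height_plus M f P"
  using canonical_height_plus_LIMSEQ[OF assms] by (rule LIMSEQ_le_const) (simp add: height_nonneg)

lemma canonical_height_plus_henon:
  assumes "function_field M" "2 \<le> degree f"
  shows "canonical_height_plus M f (henon 1 f P) = real (degree f) * canonical_height_plus M f P"
proof (rule LIMSEQ_unique)
  show "(\<lambda>N. height M ((henon 1 f ^^ N) (henon 1 f P)) / real (degree f) ^ N)
    \<longlonglongrightarrow> canonical_height_plus M f (henon 1 f P)"
    by (rule canonical_height_plus_LIMSEQ[OF assms])
  have "(\<lambda>N. real (degree f) * (height M ((henon 1 f ^^ Suc N) P) / real (degree f) ^ Suc N))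
    \<longlonglongrightarrow> real (degree f) * canonical_height_plus M f P"
    by (intro tendsto_mult_left LIMSEQ_Suc canonical_height_plus_LIMSEQ[OF assms])
  then show "(\<lambda>N. height M ((henon 1 f ^^ N) (henon 1 f P)) / real (degree f) ^ N)
    \<longlonglongrightarrow> real (degree f) * canonical_height_plus M f P"
    using assms(2) by (simp add: funpow_swap1)
qed

text \<open>The inverse sends \<open>(x, y)\<close> to \<open>(y - f(x), x)\<close>, which is the
  map of \<open>- f\<close> with the coordinates swapped. Since heights ignore the swap, the
  backward height is the forward height for \<open>- f\<close>.\<close>

lemma inv_henon: "inv_into UNIV (henon 1 f) = prod.swap \<circ> henon 1 (- f) \<circ> prod.swap"
  by (rule inv_unique_comp) (auto simp: henon_def fun_eq_iff)

lemma funpow_swap_conj: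
  fixes g :: "'a \<times> 'b \<Rightarrow> 'a \<times> 'b"
  shows "((prod.swap \<circ> g \<circ> prod.swap) ^^ N) P = prod.swap ((g ^^ N) (prod.swap P))"
  by (induction N) auto

lemma canonical_height_minus_eq:
  "canonical_height_minus M f P = canonical_height_plus M (- f) (prod.swap P)"
  unfolding canonical_height_minus_def canonical_height_plus_def inv_henon funpow_swap_conj height_swap
  by simp

lemma canonical_height_eq_0_iff:
  assumes "function_field M" "2 \<le> degree f"
  shows "canonical_height M f P = 0 \<longleftrightarrow>
    canonical_height_plus M f P = 0 \<and> canonical_height_plus M (- f) (prod.swap P) = 0"
  using canonical_height_plus_nonneg[OF assms] canonical_height_plus_nonneg[OF assms(1), of "- f"] assms(2)
  by (simp add: canonical_height_def canonical_height_minus_eq add_nonneg_eq_0_iff)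

text \<open>One step multiplies the forward height by \<open>d\<close> and divides the backward
  height by \<open>d\<close>; both are nonnegative.\<close>

lemma canonical_height_henon_eq_0_iff:
  assumes "function_field M" "2 \<le> degree f"
  shows "canonical_height M f (henon 1 f P) = 0 \<longleftrightarrow> canonical_height M f P = 0"
proof -
  have "henon 1 (- f) (prod.swap (henon 1 f P)) = prod.swap P" by (simp add: henon_def prod.swap_def)
  then have "canonical_height_plus M (- f) (prod.swap P) =
      real (degree f) * canonical_height_plus M (- f) (prod.swap (henon 1 f P))"
    using canonical_height_plus_henon[OF assms(1), of "- f" "prod.swap (henon 1 f P)"] assms(2) by simp
  then show ?thesis
    using canonical_height_plus_henon[OF assms] assms
    by (simp add: canonical_height_eq_0_iff)
qed

section \<open>Escape to infinity at a single place\<close>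

lemma nonarch_poly_dominant:
  assumes v: "nonarch_abs v" and deg: "2 \<le> degree p" and B: "\<And>i. v (coeff p i) \<le> B"
    and y: "1 < v y" "B < v (lead_coeff p) * v y" "1 < v (lead_coeff p) * v y"
  shows "v (poly p y) = v (lead_coeff p) * v y ^ degree p"
    and "v y < v (lead_coeff p) * v y ^ degree p"
proof -
  obtain n where n: "degree p = Suc n" "0 < n" using deg by (cases "degree p") auto
  have B0: "0 \<le> B" using B[of 0] nonarch_abs_nonneg[OF v] order.trans by blast
  have "v y ^ Suc 0 \<le> v y ^ n" using y n by (intro power_increasing) auto
  then have yn: "v y \<le> v y ^ n" "0 < v y ^ n" using y by auto
  \<comment> \<open>All lower terms together stay below \<open>B * v y ^ n\<close>, while the
    leading term has one more factor \<open>v y\<close>, and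
    \<open>B < v (lead_coeff p) * v y\<close>.\<close>
  have "v (\<Sum>i\<le>n. coeff p i * y ^ i) \<le> B * v y ^ n"
  proof (rule nonarch_abs_sum_le[OF v])
    fix i assume "i \<in> {..n}"
    then have "v y ^ i \<le> v y ^ n" using y by (intro power_increasing) auto
    then show "v (coeff p i * y ^ i) \<le> B * v y ^ n"
      unfolding nonarch_abs_mult[OF v] nonarch_abs_power[OF v]
      using B[of i] B0 nonarch_abs_nonneg[OF v] by (intro mult_mono) auto
  qed (use B0 yn in simp)
  also have "\<dots> < v (lead_coeff p) * v y * v y ^ n" using y yn by simp
  finally have "v (\<Sum>i\<le>n. coeff p i * y ^ i) < v (lead_coeff p * y ^ degree p)"
    by (simp add: nonarch_abs_mult[OF v] nonarch_abs_power[OF v] n mult_ac)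
  moreover have "poly p y = lead_coeff p * y ^ degree p + (\<Sum>i\<le>n. coeff p i * y ^ i)"
    unfolding poly_altdef n(1) by (simp add: add.commute)
  ultimately show "v (poly p y) = v (lead_coeff p) * v y ^ degree p"
    using nonarch_abs_add_dominant[OF v] by (simp add: nonarch_abs_mult[OF v] nonarch_abs_power[OF v])
  have "v y < v (lead_coeff p) * v y * v y ^ n"
    using mult_strict_right_mono[OF y(3) yn(2)] yn(1) by simp
  then show "v y < v (lead_coeff p) * v y ^ degree p" by (simp add: n mult_ac)
qed

text \<open>Beyond \<open>R\<close> each step replaces the size \<open>y\<close> of the second
  coordinate by \<open>L * y ^ d\<close>, so \<open>L * y ^ (d - 1)\<close> is raised to the power
  \<open>d\<close>. Starting from \<open>E > 1\<close> it grows like \<open>E ^ (d ^ N)\<close>, and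
  this one place already contributes \<open>ln E / (d - 1)\<close> to the limit.\<close>

lemma canonical_height_plus_pos:
  assumes M: "function_field M" "v \<in> M" and deg: "2 \<le> degree f"
    and dom: "\<And>y. R < v y \<Longrightarrow> v (poly f y) = v (lead_coeff f) * v y ^ degree f \<and>
                v y < v (lead_coeff f) * v y ^ degree f"
    and P: "v (fst P) \<le> v (snd P)" "R < v (snd P)"
  shows "0 < canonical_height_plus M f P"
proof -
  let ?d = "degree f" and ?n = "degree f - 1"
  define L where "L = v (lead_coeff f)"
  have v: "nonarch_abs v" using M function_field_nonarch by blast
  have n: "0 < ?n" "?d = Suc ?n" using deg by auto
  have "f \<noteq> 0" using deg by auto
  then have L: "0 < L" unfolding L_def using nonarch_abs_pos[OF v] by simp
  define E where "E = L * v (snd P) ^ ?n"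
  have esc: "v (snd P) < L * v (snd P) ^ ?d" using dom[OF P(2)] unfolding L_def by simp
  have "v (snd P) \<noteq> 0" using esc deg by (auto simp: power_0_left)
  then have y0: "0 < v (snd P)" using nonarch_abs_nonneg[OF v, of "snd P"] by simp
  have "v (snd P) * 1 < v (snd P) * E" using esc unfolding E_def by (subst (asm) n(2)) (simp add: mult_ac)
  then have E: "1 < E" using y0 by simp
  have orbit: "v (fst ((henon 1 f ^^ N) P)) \<le> v (snd ((henon 1 f ^^ N) P)) \<and>
      R < v (snd ((henon 1 f ^^ N) P)) \<and> L * v (snd ((henon 1 f ^^ N) P)) ^ ?n = E ^ (?d ^ N)" for N
  proof (induction N)
    case (Suc N)
    define Q where "Q = (henon 1 f ^^ N) P"
    define y where "y = v (snd Q)"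
    have Q: "v (fst Q) \<le> y" "R < y" "L * y ^ ?n = E ^ (?d ^ N)"
      using Suc unfolding Q_def y_def by auto
    have fQ: "v (poly f (snd Q)) = L * y ^ ?d" "y < L * y ^ ?d"
      using dom[of "snd Q"] Q unfolding L_def y_def by auto
    then have "v (poly f (snd Q) + fst Q) = L * y ^ ?d"
      using Q by (subst nonarch_abs_add_dominant[OF v]) auto
    then have new: "v (snd (henon 1 f Q)) = L * y ^ ?d" by (simp add: henon_def add.commute)
    have "L * (L * y ^ ?d) ^ ?n = (L * y ^ ?n) ^ ?d"
    proof -
      have "(y ^ ?d) ^ ?n = (y ^ ?n) ^ ?d" by (simp only: power_mult[symmetric] mult.commute)
      moreover have "L * L ^ ?n = L ^ ?d" using n by (metis power_Suc)
      ultimately show ?thesis by (simp only: power_mult_distrib mult.assoc[symmetric])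
    qed
    also have "\<dots> = E ^ (?d ^ Suc N)" unfolding Q(3) by (simp only: power_mult[symmetric] power_Suc mult.commute)
    finally have "L * (L * y ^ ?d) ^ ?n = E ^ (?d ^ Suc N)" .
    moreover have "v (fst (henon 1 f Q)) = y" by (simp add: henon_def y_def)
    moreover have "(henon 1 f ^^ Suc N) P = henon 1 f Q" by (simp add: Q_def)
    ultimately show ?case using new fQ Q(2) by simp
  qed (use P in \<open>simp add: E_def\<close>)
  have lower: "ln E / ?n - (ln L / ?n) / real ?d ^ N \<le> height M ((henon 1 f ^^ N) P) / real ?d ^ N" for N
  proof -
    define y where "y = v (snd ((henon 1 f ^^ N) P))"
    have yE: "L * y ^ ?n = E ^ (?d ^ N)" using orbit unfolding y_def by blast
    have "y \<noteq> 0" using yE E n by (auto simp: power_0_left)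
    then have y: "0 < y" using nonarch_abs_nonneg[OF v] unfolding y_def by (simp add: order_less_le)
    \<comment> \<open>Solving for \<open>ln y\<close> costs the term \<open>ln L\<close>, which
      disappears after division by \<open>d ^ N\<close>.\<close>
    have "ln L + ?n * ln y = ln (L * y ^ ?n)" using L y by (simp add: ln_mult ln_realpow)
    also have "\<dots> = real ?d ^ N * ln E" unfolding yE using E by (simp add: ln_realpow)
    finally have "ln y = (real ?d ^ N * ln E - ln L) / ?n" using n by (simp add: field_simps)
    moreover have "ln y \<le> ln (local_max v ((henon 1 f ^^ N) P))"
      using y local_max_ge(3)[of v] unfolding y_def by (intro ln_mono) auto
    ultimately have "(real ?d ^ N * ln E - ln L) / ?n \<le> height M ((henon 1 f ^^ N) P)"
      using height_ge_local[OF M, of "(henon 1 f ^^ N) P"] by (metis order.trans)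
    then have "(real ?d ^ N * ln E - ln L) / ?n / real ?d ^ N \<le> height M ((henon 1 f ^^ N) P) / real ?d ^ N"
      by (intro divide_right_mono) auto
    also have "(real ?d ^ N * ln E - ln L) / ?n / real ?d ^ N = ln E / ?n - (ln L / ?n) / real ?d ^ N"
      using deg by (simp add: diff_divide_distrib)
    finally show ?thesis .
  qed
  have "(\<lambda>N. (ln L / ?n) / real ?d ^ N) \<longlonglongrightarrow> 0"
    using deg by (intro LIMSEQ_divide_realpow_zero) auto
  then have "(\<lambda>N. ln E / ?n - (ln L / ?n) / real ?d ^ N) \<longlonglongrightarrow> ln E / ?n - 0"
    by (intro tendsto_intros)
  then have "ln E / ?n - 0 \<le> canonical_height_plus M f P"
    by (rule LIMSEQ_le[OF _ canonical_height_plus_LIMSEQ[OF M(1) deg]]) (use lower in auto)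
  moreover have "0 < ln E / ?n" using E n by simp
  ultimately show ?thesis by simp
qed

text \<open>Beyond \<open>R\<close> the leading term of \<open>f\<close> dominates. If the larger
  coordinate lay beyond \<open>R\<close>, the forward orbit would escape when it is the second one,
  and the backward orbit, seen as the orbit of the swapped point under the map of
  \<open>- f\<close>, when it is the first one.\<close>

lemma canonical_height_0_bounded:
  assumes M: "function_field M" "v \<in> M" and deg: "2 \<le> degree f"
    and R: "1 \<le> R" "\<And>i. v (coeff f i) \<le> B" "B \<le> v (lead_coeff f) * R" "1 \<le> v (lead_coeff f) * R"
    and P: "canonical_height M f P = 0"
  shows "v (fst P) \<le> R" "v (snd P) \<le> R"
proof -
  let ?L = "v (lead_coeff f)"
  have v: "nonarch_abs v" using M function_field_nonarch by blast
  have "f \<noteq> 0" using deg by auto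
  then have L: "0 < ?L" using nonarch_abs_pos[OF v] by simp
  have dom: "v (poly f y) = ?L * v y ^ degree f \<and> v y < ?L * v y ^ degree f" if "R < v y" for y
  proof -
    have "?L * R < ?L * v y" using that L by simp
    then show ?thesis using nonarch_poly_dominant[OF v deg R(2), of y] R that by simp
  qed
  have dom': "v (poly (- f) y) = v (lead_coeff (- f)) * v y ^ degree (- f) \<and>
      v y < v (lead_coeff (- f)) * v y ^ degree (- f)" if "R < v y" for y
    using dom[OF that] by (simp add: nonarch_abs_minus[OF v])
  have zero: "canonical_height_plus M f P = 0" "canonical_height_plus M (- f) (prod.swap P) = 0"
    using P canonical_height_eq_0_iff[OF M(1) deg] by auto
  have "\<not> (v (fst P) \<le> v (snd P) \<and> R < v (snd P))"
    using canonical_height_plus_pos[OF M deg, of R P] dom zero by fastforce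
  moreover have "\<not> (v (snd P) \<le> v (fst P) \<and> R < v (fst P))"
    using canonical_height_plus_pos[OF M, of "- f" R "prod.swap P"] dom' zero deg by fastforce
  ultimately have "max (v (fst P)) (v (snd P)) \<le> R" by auto
  then show "v (fst P) \<le> R" "v (snd P) \<le> R" by auto
qed

lemma canonical_height_periodic:
  assumes M: "function_field M" and deg: "2 \<le> degree f" and P: "periodic (henon 1 f) P"
  shows "canonical_height M f P = 0"
proof -
  have plus: "canonical_height_plus M f P = 0"
    if deg: "2 \<le> degree f" and n: "n \<ge> 1" "(henon 1 f ^^ n) P = P" for f n P
  proof -
    have "canonical_height_plus M f ((henon 1 f ^^ n) P) = real (degree f) ^ n * canonical_height_plus M f P" for n
      using canonical_height_plus_henon[OF M deg] by (induction n) auto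
    from this[of n] have "(real (degree f) ^ n - 1) * canonical_height_plus M f P = 0"
      using n by (simp add: algebra_simps)
    moreover have "1 < real (degree f) ^ n" using deg n by (intro one_less_power) auto
    ultimately show ?thesis by simp
  qed
  obtain n where n: "n \<ge> 1" "(henon 1 f ^^ n) P = P" using P by (auto simp: periodic_def)
  \<comment> \<open>After swapping, the map of \<open>- f\<close> undoes the map of
    \<open>f\<close>, so the swapped point is periodic with the same \<open>n\<close> and the
    forward argument applies to it.\<close>
  have "(henon 1 (- f) ^^ n) (prod.swap ((henon 1 f ^^ n) P)) = prod.swap P" for n
  proof (induction n)
    case (Suc n)
    have "henon 1 (- f) (prod.swap (henon 1 f Q)) = prod.swap Q" for Q
      by (simp add: henon_def prod.swap_def)
    have "(henon 1 (- f) ^^ Suc n) (prod.swap ((henon 1 f ^^ Suc n) P)) =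
        (henon 1 (- f) ^^ n) (henon 1 (- f) (prod.swap (henon 1 f ((henon 1 f ^^ n) P))))"
      by (subst funpow_Suc_right) simp
    then show ?case using Suc \<open>\<And>Q. henon 1 (- f) (prod.swap (henon 1 f Q)) = prod.swap Q\<close> by simp
  qed simp
  from this[of n] have "(henon 1 (- f) ^^ n) (prod.swap P) = prod.swap P" using n by simp
  then show ?thesis
    using plus[OF deg n] plus[of "- f" n "prod.swap P"] n deg canonical_height_eq_0_iff[OF M deg] by simp
qed

subsection \<open>Isotriviality and the roots of the polynomial\<close>

lemma nonarch_monic_coeff_le_1:
  assumes w: "nonarch_abs w" and roots: "\<And>x. x \<in># A \<Longrightarrow> w x \<le> 1"
  shows "w (coeff (\<Prod>x\<in>#A. [:- x, 1:]) i) \<le> 1"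
  using roots
proof (induction A arbitrary: i)
  case empty
  then show ?case using w by (cases i) (auto simp: nonarch_abs_1 nonarch_abs_0)
next
  case (add x A)
  define q where "q = (\<Prod>x\<in>#A. [:- x, 1:])"
  have q: "w (coeff q i) \<le> 1" for i unfolding q_def using add by auto
  have "w (x * coeff q i) \<le> 1" for i
    using q[of i] add.prems[of x] nonarch_abs_nonneg[OF w] by (simp add: nonarch_abs_mult[OF w] mult_le_one)
  moreover have "w (coeff (pCons 0 q) i) \<le> 1"
    using q nonarch_abs_0[OF w] by (cases i) (auto simp: coeff_pCons)
  ultimately have "w (coeff (pCons 0 q) i - x * coeff q i) \<le> 1"
    using nonarch_abs_diff[OF w] by (meson max.bounded_iff order.trans)
  then show ?case by (simp add: q_def[symmetric])
qed

lemma degree_map_to_ac: "degree (map_poly to_ac f) = degree f"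
  by (intro degree_map_poly) auto

lemma lead_coeff_map_to_ac: "lead_coeff (map_poly to_ac f) = to_ac (lead_coeff f)"
  by (simp add: degree_map_to_ac coeff_map_poly)

lemma poly_map_to_ac: "poly (map_poly to_ac f) (to_ac x) = to_ac (poly f x)"
  by (simp add: poly_altdef degree_map_to_ac coeff_map_poly to_ac_sum)

text \<open>By contraposition: if for every extension of every place all roots lie in one class, an
  affine change of coordinates gives a monic polynomial with constant roots, and by
  \<open>nonarch_monic_coeff_le_1\<close> its coefficients are constants too.\<close>

lemma not_isotrivial_spread_roots:
  fixes M :: "('a::field \<Rightarrow> real) set"
  defines "F \<equiv> map_poly to_ac"
  assumes deg: "2 \<le> degree f" and "\<not> isotrivial M f"
  shows "\<exists>v\<in>M. \<exists>w r s. extends_abs w v \<and> poly (F f) r = 0 \<and> poly (F f) s = 0 \<and>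
           1 < w (lead_coeff (F f)) * w (r - s) ^ (degree f - 1)"
proof (rule ccontr)
  assume contra: "\<not> ?thesis"
  let ?d = "degree f" and ?n = "degree f - 1"
  let ?F = "map_poly to_ac f"
  have dF: "degree ?F = ?d" by (rule degree_map_to_ac)
  have n: "0 < ?n" "?d = Suc ?n" using deg by auto
  have "f \<noteq> 0" using deg by auto
  then have lc0: "lead_coeff ?F \<noteq> 0" by (simp add: lead_coeff_map_to_ac del: leading_coeff_0_iff) simp
  obtain c where c: "c ^ ?n = lead_coeff ?F" using nth_root_exists[OF n(1)] by blast
  have c0: "c \<noteq> 0" using c lc0 n(1) by (metis zero_power)
  obtain r where r: "poly ?F r = 0" using alg_closed_imp_poly_has_root[of ?F] dF deg by auto
  \<comment> \<open>Scaling by \<open>c\<close> makes the polynomial monic, and moving \<open>r\<close> to 0 makes its roots constants.\<close>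
  define q where "q = [:r, inverse c:]"
  define g where "g = smult c (pcompose ?F q)"
  have q: "degree q = 1" "lead_coeff q = inverse c" unfolding q_def using c0 by auto
  have dg: "degree g = ?d" unfolding g_def using c0 q(1) dF by (simp add: degree_pcompose)
  have "lead_coeff g = c * (lead_coeff ?F * lead_coeff q ^ ?d)"
    unfolding g_def using q dF by (simp only: lead_coeff_smult lead_coeff_comp)
  also have "\<dots> = c ^ ?d * inverse c ^ ?d"
    unfolding c[symmetric] q(2) by (subst power_minus_mult[of ?d c, symmetric]) (use deg in \<open>simp_all add: mult_ac\<close>)
  also have "\<dots> = 1" using c0 by (simp add: power_mult_distrib[symmetric])
  finally have lg: "lead_coeff g = 1" .
  then have "g \<noteq> 0" by auto
  then obtain A where A: "g = (\<Prod>x\<in>#A. [:- x, 1:])"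
    using alg_closed_imp_factorization[of g] lg by auto
  have gpoly: "poly g x = c * poly ?F (r + x / c)" for x
    unfolding g_def q_def by (simp add: poly_pcompose field_simps)
  have g_const: "coeff g i \<in> constants M" for i
    unfolding constants_def
  proof clarify
    fix v w assume v: "v \<in> M" and w: "extends_abs w v"
    then have na: "nonarch_abs w" by (simp add: extends_abs_def)
    have "w x \<le> 1" if "x \<in># A" for x
    proof -
      \<comment> \<open>A root \<open>x\<close> of \<open>g\<close> comes from the root
        \<open>r + x / c\<close> of \<open>?F\<close>, and by the choice of \<open>c\<close> the
        class condition for this root and \<open>r\<close> reads
        \<open>w x ^ (d - 1) \<le> 1\<close>.\<close>
      have "poly g x = 0" unfolding A poly_prod_mset using that by (auto intro!: prod_mset_zero_iff[THEN iffD2])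
      then have "poly ?F (r + x / c) = 0" using gpoly c0 by simp
      then have "\<not> 1 < w (lead_coeff ?F) * w (r + x / c - r) ^ ?n"
        using contra v w r unfolding F_def by blast
      moreover have "w (lead_coeff ?F) * w (r + x / c - r) ^ ?n = w x ^ ?n"
      proof -
        have "lead_coeff ?F * (x / c) ^ ?n = x ^ ?n"
          unfolding c[symmetric] using c0 by (simp add: power_divide)
        then have "w (lead_coeff ?F * (x / c) ^ ?n) = w (x ^ ?n)" by simp
        then show ?thesis by (simp add: nonarch_abs_mult[OF na] nonarch_abs_power[OF na])
      qed
      ultimately have "\<not> 1 < w x ^ ?n" by simp
      then show ?thesis using one_less_power[of "w x" ?n] n(1) by linarith
    qed
    then show "w (coeff g i) \<le> 1" unfolding A by (intro nonarch_monic_coeff_le_1[OF na])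
  qed
  have one_const: "1 \<in> constants M"
    by (auto simp: constants_def extends_abs_def nonarch_abs_1)
  \<comment> \<open>Both coordinates get the same scaling, which keeps the coefficient
    \<open>a = 1\<close>, and the same translation, which cancels outside the argument of the
    polynomial.\<close>
  let ?\<psi> = "affine_map (inverse c) 0 r 0 (inverse c) r"
  have inv: "inv_into UNIV ?\<psi> = (\<lambda>P. (c * (fst P - r), c * (snd P - r)))"
    using c0 by (intro inv_unique_comp) (simp_all add: affine_map_def fun_eq_iff mult.assoc[symmetric])
  have "henon 1 g (x, y) = (inv_into UNIV ?\<psi> \<circ> henon 1 ?F \<circ> ?\<psi>) (x, y)" for x y
  proof -
    have "poly g y = c * poly ?F (inverse c * y + r)"
      by (simp only: gpoly divide_inverse_commute add.commute)
    moreover have "c * (inverse c * z) = z" for z using c0 by (simp add: mult.assoc[symmetric])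
    ultimately show ?thesis
      unfolding inv by (simp add: henon_def affine_map_def right_diff_distrib distrib_left)
  qed
  then have "henon 1 g = inv_into UNIV ?\<psi> \<circ> henon 1 ?F \<circ> ?\<psi>" by (intro ext) (metis surj_pair)
  moreover have "inverse c * inverse c - 0 * 0 \<noteq> 0" using c0 by simp
  ultimately have "affine_conjugate (henon 1 ?F) (henon 1 g)"
    unfolding affine_conjugate_def by blast
  then have "isotrivial M f"
    unfolding isotrivial_def using g_const one_const dg deg by (intro exI[of _ 1] exI[of _ g]) auto
  then show False using assms by blast
qed

subsection \<open>Points of canonical height zero\<close>

lemma inj_henon: "inj (henon 1 f)"
  by (auto simp: inj_def henon_def prod_eq_iff)

text \<open>By the pigeonhole principle two iterates of \<open>P\<close> coincide, and injectivity
  cancels the preperiod.\<close>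

lemma periodic_of_finite_orbit:
  assumes "inj \<phi>" "finite Z" "\<And>n. (\<phi> ^^ n) P \<in> Z"
  shows "periodic \<phi> P"
proof -
  have "finite (range (\<lambda>n. (\<phi> ^^ n) P))"
    by (rule finite_subset[OF _ assms(2)]) (use assms(3) in blast)
  then have "\<not> inj (\<lambda>n. (\<phi> ^^ n) P)" using finite_imageD[of _ UNIV] by auto
  then obtain i j where "i < j" "(\<phi> ^^ i) P = (\<phi> ^^ j) P"
    unfolding inj_def by (metis linorder_neqE_nat)
  moreover then have "(\<phi> ^^ j) P = (\<phi> ^^ i) ((\<phi> ^^ (j - i)) P)"
    using funpow_add[of i "j - i" \<phi>] by simp
  ultimately have "(\<phi> ^^ i) ((\<phi> ^^ (j - i)) P) = (\<phi> ^^ i) P" by simp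
  then have "(\<phi> ^^ (j - i)) P = P" using inj_fn[OF assms(1), of i] by (simp only: inj_eq)
  moreover have "1 \<le> j - i" using \<open>i < j\<close> by simp
  ultimately show ?thesis unfolding periodic_def by blast
qed

lemma zero_height_bounded:
  assumes M: "function_field M" "v \<in> M" and deg: "2 \<le> degree f"
  shows "\<exists>R. \<forall>u\<in>fst ` {P. canonical_height M f P = 0}. v u \<le> R"
proof -
  let ?L = "v (lead_coeff f)" and ?B = "coeff_bound v f"
  have v: "nonarch_abs v" using M function_field_nonarch by blast
  have "f \<noteq> 0" using deg by auto
  then have L: "0 < ?L" using nonarch_abs_pos[OF v] by simp
  \<comment> \<open>The three entries are the three lower bounds on the radius that
    \<open>canonical_height_0_bounded\<close> requires.\<close>
  define R where "R = max 1 (max (?B / ?L) (1 / ?L))"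
  have "?B / ?L \<le> R" "1 / ?L \<le> R" "1 \<le> R" unfolding R_def by auto
  then have "?B \<le> ?L * R" "1 \<le> ?L * R" using L by (auto simp: field_simps)
  then show ?thesis
    using canonical_height_0_bounded(1)[OF M deg \<open>1 \<le> R\<close> coeff_bound(1)[OF v]] by blast
qed

section \<open>Good and bad reduction, and the product formula\<close>

lemma good_reduction_coeff:
  assumes "\<not> bad_reduction v f"
  shows "v (coeff f i) \<le> 1" "v (lead_coeff f) = 1"
  using assms unfolding bad_reduction_def by (auto simp: not_less intro: antisym)

lemma finite_bad_reduction:
  assumes M: "function_field M" and "f \<noteq> 0"
  shows "finite {v \<in> M. bad_reduction v f}"
proof (rule finite_subset)
  show "{v \<in> M. bad_reduction v f} \<subseteq>
    {v \<in> M. coeff_bound v f \<noteq> 1} \<union> {v \<in> M. lead_coeff f \<noteq> 0 \<and> v (lead_coeff f) \<noteq> 1}"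
  proof
    fix v assume v: "v \<in> {v \<in> M. bad_reduction v f}"
    have "coeff_bound v f \<noteq> 1" if "1 < v (coeff f i)" for i
      using that coeff_bound(1)[of v f i] function_field_nonarch[OF M] v by auto
    then show "v \<in> {v \<in> M. coeff_bound v f \<noteq> 1} \<union> {v \<in> M. lead_coeff f \<noteq> 0 \<and> v (lead_coeff f) \<noteq> 1}"
      using v \<open>f \<noteq> 0\<close> unfolding bad_reduction_def by auto
  qed
  show "finite ({v \<in> M. coeff_bound v f \<noteq> 1} \<union> {v \<in> M. lead_coeff f \<noteq> 0 \<and> v (lead_coeff f) \<noteq> 1})"
    using finite_coeff_bound[OF M] function_field_finite[OF M] by blast
qed

lemma product_formula_strict_contradiction:
  assumes M: "function_field M" and e: "e \<noteq> 0" and le: "\<And>v. v \<in> M \<Longrightarrow> v e \<le> 1"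
    and v\<^sub>0: "v\<^sub>0 \<in> M" "v\<^sub>0 e < 1"
  shows False
proof -
  define S where "S = {v \<in> M. v e \<noteq> 1}"
  have S: "finite S" "(\<Prod>v\<in>S. v e) = 1" using M e unfolding function_field_def S_def by auto
  have "(\<Prod>v\<in>S - {v\<^sub>0}. v e) \<le> 1"
    using le nonarch_abs_nonneg function_field_nonarch[OF M] by (intro prod_le_1) (auto simp: S_def)
  moreover have "(\<Prod>v\<in>S. v e) = v\<^sub>0 e * (\<Prod>v\<in>S - {v\<^sub>0}. v e)"
    using S v\<^sub>0 by (intro prod.remove) (auto simp: S_def)
  moreover have "0 \<le> v\<^sub>0 e" using nonarch_abs_nonneg function_field_nonarch[OF M] v\<^sub>0 by blast
  ultimately have "1 \<le> v\<^sub>0 e * 1" using S mult_left_mono[of "\<Prod>v\<in>S - {v\<^sub>0}. v e" 1 "v\<^sub>0 e"] by linarith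
  then show False using v\<^sub>0 by simp
qed

text \<open>A root with \<open>w x > 1\<close> would make the leading term dominate, so at a good
  place all roots are integral. Hence the place at which the roots spread is among the bad
  ones.\<close>

lemma good_reduction_no_spread:
  fixes f :: "'a::field poly"
  defines "F \<equiv> map_poly to_ac f"
  assumes deg: "2 \<le> degree f" and w: "extends_abs w v" and good: "\<not> bad_reduction v f"
    and roots: "poly F r = 0" "poly F s = 0"
  shows "w (lead_coeff F) * w (r - s) ^ n \<le> 1"
proof -
  have na: "nonarch_abs w" and ext: "\<And>x. w (to_ac x) = v x" using w by (auto simp: extends_abs_def)
  have dF: "degree F = degree f" and lc: "w (lead_coeff F) = 1" and B: "w (coeff F i) \<le> 1" for i
    using good_reduction_coeff[OF good] unfolding F_def
    by (simp_all add: degree_map_to_ac coeff_map_poly ext)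
  have "w x \<le> 1" if "poly F x = 0" for x
  proof (rule ccontr)
    assume "\<not> w x \<le> 1"
    then have "w (poly F x) = w x ^ degree F" "1 < w x"
      using nonarch_poly_dominant(1)[OF na _ B, of x] deg dF lc by auto
    then show False using that nonarch_abs_0[OF na] by simp
  qed
  from this[OF roots(1)] this[OF roots(2)] have "w (r - s) \<le> 1"
    using nonarch_abs_diff[OF na, of r s] by simp
  then show ?thesis using lc nonarch_abs_nonneg[OF na] by (simp add: power_le_one)
qed

text \<open>The set \<open>Z\<close> is invariant under the map and its inverse. The second
  coordinate of \<open>P\<close> is the first coordinate of its image, so the first coordinates
  along an orbit satisfy a second order recurrence.\<close>

lemma zero_height_coordinate_dyn:
  assumes "function_field M" "2 \<le> degree f"
  defines "Z \<equiv> {P. canonical_height M f P = 0}"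
  shows "P \<in> Z \<Longrightarrow> snd P \<in> fst ` Z"
    and "u \<in> fst ` Z \<Longrightarrow> \<exists>a\<in>fst ` Z. \<exists>b\<in>fst ` Z. poly f u = a - b"
proof -
  have inv: "henon 1 f P \<in> Z \<longleftrightarrow> P \<in> Z" for P
    unfolding Z_def using canonical_height_henon_eq_0_iff[OF assms(1,2)] by simp
  show snd_in: "snd P \<in> fst ` Z" if "P \<in> Z" for P
    using inv[of P] that by (intro image_eqI[of _ _ "henon 1 f P"]) (auto simp: henon_def)
  assume "u \<in> fst ` Z"
  then obtain P where P: "P \<in> Z" "u = fst P" by blast
  \<comment> \<open>\<open>P'\<close> is the predecessor of \<open>P\<close> in its orbit.\<close>
  define P' where "P' = (snd P - poly f u, u)"
  have "henon 1 f P' = P" unfolding P'_def P by (simp add: henon_def)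
  then have "P' \<in> Z" using inv[of P'] P by simp
  then have "fst P' \<in> fst ` Z" by blast
  moreover have "poly f u = snd P - fst P'" by (simp add: P'_def)
  ultimately show "\<exists>a\<in>fst ` Z. \<exists>b\<in>fst ` Z. poly f u = a - b" using snd_in[OF P(1)] by blast
qed

text \<open>The coordinates in \<open>U\<close> may all lie in one class, so the spread is borrowed
  from the roots of \<open>F\<close>, at the price of working over the algebraic closure.\<close>

lemma zero_height_strict_code:
  fixes f :: "'a::field poly"
  assumes M: "function_field M" and deg: "2 \<le> degree f"
  defines "U \<equiv> fst ` {P. canonical_height M f P = 0}" and "F \<equiv> map_poly to_ac f"
  assumes v: "v \<in> M" and w: "extends_abs w v"
    and roots: "poly F r = 0" "poly F s = 0"
    and spread: "1 < w (lead_coeff F) * w (r - s) ^ (degree f - 1)"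
  shows "\<exists>\<kappa> :: 'a \<Rightarrow> nat \<times> nat \<times> nat \<times> nat.
           \<kappa> ` U \<subseteq> {..<degree f} \<times> {..<degree f} \<times> {..<degree f} \<times> {..<degree f} \<and>
           (\<forall>x\<in>U. \<forall>y\<in>U. \<kappa> x = \<kappa> y \<longrightarrow> v (lead_coeff f) * v (x - y) ^ (degree f - 1) < 1)"
proof -
  have na: "nonarch_abs w" and ext: "\<And>x. w (to_ac x) = v x" using w by (auto simp: extends_abs_def)
  have dF: "degree F = degree f" unfolding F_def by (rule degree_map_to_ac)
  have lc: "w (lead_coeff F) = v (lead_coeff f)" unfolding F_def lead_coeff_map_to_ac ext ..
  \<comment> \<open>Adjoining the roots preserves the dynamical condition, since a root
    \<open>y\<close> satisfies \<open>poly F y = y - y\<close>.\<close>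
  define Y where "Y = to_ac ` U \<union> {x. poly F x = 0}"
  obtain R where R: "\<And>u. u \<in> U \<Longrightarrow> v u \<le> R"
    using zero_height_bounded[OF M v deg] unfolding U_def by blast
  have "F \<noteq> 0" using dF deg by auto
  then have fin: "finite {x. poly F x = 0}" by (rule poly_roots_finite)
  define C where "C = max R (Max (w ` {x. poly F x = 0}))"
  have C: "w y \<le> C" if "y \<in> Y" for y
  proof (cases "y \<in> to_ac ` U")
    case True
    then have "w y \<le> R" using R ext by auto
    then show ?thesis unfolding C_def by simp
  next
    case False
    then have "w y \<le> Max (w ` {x. poly F x = 0})" using that fin unfolding Y_def by (intro Max_ge) auto
    then show ?thesis unfolding C_def by simp
  qed
  have dyn: "\<exists>a\<in>Y. \<exists>b\<in>Y. poly F y = a - b" if "y \<in> Y" for y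
  proof (cases "y \<in> to_ac ` U")
    case True
    then obtain u where u: "u \<in> U" "y = to_ac u" by blast
    then obtain a b where ab: "a \<in> U" "b \<in> U" "poly f u = a - b"
      using zero_height_coordinate_dyn(2)[OF M deg] unfolding U_def by blast
    then have "poly F y = to_ac a - to_ac b" unfolding u(2) F_def poly_map_to_ac by simp
    moreover have "to_ac a \<in> Y" "to_ac b \<in> Y" using ab unfolding Y_def by auto
    ultimately show ?thesis by blast
  next
    case False
    then have "poly F y = y - y" using that unfolding Y_def by simp
    then show ?thesis using that by blast
  qed
  have "r \<in> Y" "s \<in> Y" using roots unfolding Y_def by auto
  moreover have "1 < w (lead_coeff F) * w (r - s) ^ (degree F - 1)" using spread dF by simp
  moreover have "2 \<le> degree F" using deg dF by simp
  ultimately obtain \<kappa> :: "'a alg_closure \<Rightarrow> nat \<times> nat \<times> nat \<times> nat" where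
    \<kappa>: "\<kappa> ` Y \<subseteq> {..<degree f} \<times> {..<degree f} \<times> {..<degree f} \<times> {..<degree f}"
      "\<And>x y. x \<in> Y \<Longrightarrow> y \<in> Y \<Longrightarrow> \<kappa> x = \<kappa> y \<Longrightarrow> w (lead_coeff F) * w (x - y) ^ (degree f - 1) < 1"
    using nonarch_bounded_strict_classes[OF na _ C dyn, of r s] dF by metis
  have inY: "to_ac x \<in> Y" if "x \<in> U" for x using that unfolding Y_def by blast
  have "(\<kappa> \<circ> to_ac) ` U \<subseteq> {..<degree f} \<times> {..<degree f} \<times> {..<degree f} \<times> {..<degree f}"
    using \<kappa>(1) inY unfolding image_subset_iff o_apply by blast
  moreover have "v (lead_coeff f) * v (x - y) ^ (degree f - 1) < 1"
    if "x \<in> U" "y \<in> U" "(\<kappa> \<circ> to_ac) x = (\<kappa> \<circ> to_ac) y" for x y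
    using \<kappa>(2)[OF inY inY, of x y] that by (simp add: lc ext flip: to_ac_diff)
  ultimately show ?thesis by blast
qed

text \<open>The strict code at the place \<open>v\<^sub>0\<close> of the spread roots takes at most
  \<open>d ^ 4\<close> values, the weak codes at the other \<open>s - 1\<close> bad places at most
  \<open>d\<close> each. Jointly they are injective on \<open>U\<close> by the product
  formula.\<close>

lemma zero_height_coordinates_card:
  fixes f :: "'a::field poly"
  assumes M: "function_field M" and deg: "2 \<le> degree f" and niso: "\<not> isotrivial M f"
  defines "U \<equiv> fst ` {P. canonical_height M f P = 0}"
    and "s \<equiv> card {v \<in> M. bad_reduction v f}"
  shows "1 \<le> s" "finite U" "card U \<le> degree f ^ (s + 3)"
proof -
  let ?d = "degree f" and ?n = "degree f - 1" and ?lc = "lead_coeff f"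
  define Bd where "Bd = {v \<in> M. bad_reduction v f}"
  have "f \<noteq> 0" using deg by auto
  then have lc0: "?lc \<noteq> 0" and finBd: "finite Bd"
    using finite_bad_reduction[OF M] unfolding Bd_def by auto
  obtain v\<^sub>0 w r r' where v\<^sub>0: "v\<^sub>0 \<in> M" and w: "extends_abs w v\<^sub>0"
    and roots: "poly (map_poly to_ac f) r = 0" "poly (map_poly to_ac f) r' = 0"
    and spread: "1 < w (lead_coeff (map_poly to_ac f)) * w (r - r') ^ ?n"
    using not_isotrivial_spread_roots[OF deg niso] by blast
  have "bad_reduction v\<^sub>0 f"
    using good_reduction_no_spread[OF deg w _ roots, of ?n] spread by linarith
  then have v\<^sub>0Bd: "v\<^sub>0 \<in> Bd" using v\<^sub>0 unfolding Bd_def by simp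
  then show s1: "1 \<le> s" using finBd unfolding s_def Bd_def[symmetric] by (simp add: card_gt_0_iff Suc_le_eq) blast
  let ?Q = "{..<?d} \<times> {..<?d} \<times> {..<?d} \<times> {..<?d}"
  obtain \<kappa>\<^sub>0 :: "'a \<Rightarrow> nat \<times> nat \<times> nat \<times> nat" where \<kappa>\<^sub>0: "\<kappa>\<^sub>0 ` U \<subseteq> ?Q"
    "\<And>x y. x \<in> U \<Longrightarrow> y \<in> U \<Longrightarrow> \<kappa>\<^sub>0 x = \<kappa>\<^sub>0 y \<Longrightarrow> v\<^sub>0 ?lc * v\<^sub>0 (x - y) ^ ?n < 1"
    using zero_height_strict_code[OF M deg v\<^sub>0 w roots spread, folded U_def]
    by (elim exE conjE) (rule that, assumption, blast)
  have "\<exists>\<kappa> :: 'a \<Rightarrow> nat. \<kappa> ` U \<subseteq> {..<?d} \<and>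
      (\<forall>x\<in>U. \<forall>y\<in>U. \<kappa> x = \<kappa> y \<longrightarrow> v ?lc * v (x - y) ^ ?n \<le> 1)" if v: "v \<in> M" for v
  proof -
    obtain R where R: "\<And>u. u \<in> U \<Longrightarrow> v u \<le> R"
      using zero_height_bounded[OF M v deg] unfolding U_def by blast
    have "\<exists>a\<in>U. \<exists>b\<in>U. poly f u = a - b" if "u \<in> U" for u
      using zero_height_coordinate_dyn(2)[OF M deg] that unfolding U_def by blast
    then show ?thesis by (intro nonarch_bounded_classes[of v f U R] function_field_nonarch[OF M] v deg R)
  qed
  then have "\<forall>v\<in>M. \<exists>\<kappa> :: 'a \<Rightarrow> nat. \<kappa> ` U \<subseteq> {..<?d} \<and>
      (\<forall>x\<in>U. \<forall>y\<in>U. \<kappa> x = \<kappa> y \<longrightarrow> v ?lc * v (x - y) ^ ?n \<le> 1)" ..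
  from bchoice[OF this] obtain \<kappa> :: "('a \<Rightarrow> real) \<Rightarrow> 'a \<Rightarrow> nat" where
    \<kappa>: "\<And>v. v \<in> M \<Longrightarrow> \<kappa> v ` U \<subseteq> {..<?d}"
      "\<And>v x y. v \<in> M \<Longrightarrow> x \<in> U \<Longrightarrow> y \<in> U \<Longrightarrow> \<kappa> v x = \<kappa> v y \<Longrightarrow> v ?lc * v (x - y) ^ ?n \<le> 1"
    by (elim exE) (rule that, blast+)
  \<comment> \<open>\<open>restrict\<close> makes the second component an extensional function, so
    that the codes lie in a finite set \<open>PiE\<close> of known size.\<close>
  define code where "code u = (\<kappa>\<^sub>0 u, restrict (\<lambda>v. \<kappa> v u) (Bd - {v\<^sub>0}))" for u
  have good: "v ?lc * v (x - y) ^ ?n \<le> 1" if "v \<in> M" "v \<notin> Bd" "x \<in> U" "y \<in> U" for v x y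
  proof -
    have nb: "\<not> bad_reduction v f" and na: "nonarch_abs v"
      using that function_field_nonarch[OF M] unfolding Bd_def by auto
    \<comment> \<open>At a good place all coefficients are integral and the leading one is a unit,
      so 1 serves as escape radius.\<close>
    have le1: "v u \<le> 1" if "u \<in> U" for u
      using canonical_height_0_bounded(1)[OF M \<open>v \<in> M\<close> deg, of 1 1] good_reduction_coeff[OF nb] that
      unfolding U_def by auto
    have "v (x - y) \<le> 1" using nonarch_abs_diff[OF na, of x y] le1[OF that(3)] le1[OF that(4)] by simp
    then show ?thesis using good_reduction_coeff(2)[OF nb] nonarch_abs_nonneg[OF na] by (simp add: power_le_one)
  qed
  have inj: "inj_on code U"
  proof (rule inj_onI, rule ccontr)
    fix x y assume xy: "x \<in> U" "y \<in> U" "code x = code y" "x \<noteq> y"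
    \<comment> \<open>The class conditions for \<open>x\<close> and \<open>y\<close> at all places
      are conditions on the size of this single element of the field.\<close>
    define e where "e = ?lc * (x - y) ^ ?n"
    have ve: "v e = v ?lc * v (x - y) ^ ?n" if "v \<in> M" for v
      using function_field_nonarch[OF M that] unfolding e_def by (simp add: nonarch_abs_mult nonarch_abs_power)
    have \<kappa>eq: "\<kappa>\<^sub>0 x = \<kappa>\<^sub>0 y" "\<And>v. v \<in> Bd - {v\<^sub>0} \<Longrightarrow> \<kappa> v x = \<kappa> v y"
      using xy(3) unfolding code_def by (auto dest: fun_cong simp: restrict_def split: if_splits)
    have strict: "v\<^sub>0 e < 1" using \<kappa>\<^sub>0(2)[OF xy(1,2) \<kappa>eq(1)] ve[OF v\<^sub>0] by simp
    have "v e \<le> 1" if "v \<in> M" for v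
      using good[OF that _ xy(1,2)] \<kappa>(2)[OF that xy(1,2)] \<kappa>eq(2)[of v] strict ve[OF that]
      by (cases "v = v\<^sub>0"; cases "v \<in> Bd") auto
    moreover have "e \<noteq> 0" using lc0 xy(4) unfolding e_def by simp
    ultimately show False using product_formula_strict_contradiction[OF M _ _ v\<^sub>0 strict] by blast
  qed
  let ?T = "?Q \<times> (Bd - {v\<^sub>0} \<rightarrow>\<^sub>E {..<?d})"
  have sub: "code ` U \<subseteq> ?T"
    using \<kappa>\<^sub>0(1) \<kappa>(1) unfolding code_def Bd_def by (auto simp: image_subset_iff)
  have finT: "finite ?T" using finBd by (intro finite_cartesian_product finite_PiE) auto
  show "finite U" using inj sub finT by (meson finite_imageD finite_subset)
  have "card U = card (code ` U)" using inj by (simp add: card_image)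
  also have "\<dots> \<le> card ?T" using sub finT by (intro card_mono)
  also have "\<dots> = ?d ^ 4 * ?d ^ (s - 1)"
    using finBd v\<^sub>0Bd unfolding s_def Bd_def[symmetric]
    by (simp add: card_cartesian_product card_funcsetE power_numeral_reduce)
  \<comment> \<open>The truncated difference \<open>s - 1\<close> is a true one because
    \<open>v\<^sub>0\<close> is bad.\<close>
  also have "\<dots> = ?d ^ (s + 3)" using s1 by (simp add: power_add[symmetric] add.commute)
  finally show "card U \<le> ?d ^ (s + 3)" .
qed

theorem theorem2:
  fixes M :: "('a::field \<Rightarrow> real) set" and f :: "'a poly"
  assumes "function_field M"
    and "2 \<le> degree f"
  shows "(isotrivial M f \<or>
            (finite {P. canonical_height M f P = 0} \<and>
             card {P. canonical_height M f P = 0}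
               \<le> zero_height_bound (degree f) (card {v \<in> M. bad_reduction v f}))) \<and>
         (\<not> isotrivial M f \<longrightarrow>
            (\<forall>P. canonical_height M f P = 0 \<longleftrightarrow> periodic (henon 1 f) P))"
proof (cases "isotrivial M f")
  case False
  define Z where "Z = {P. canonical_height M f P = 0}"
  define s where "s = card {v \<in> M. bad_reduction v f}"
  let ?d = "degree f"
  have U: "1 \<le> s" "finite (fst ` Z)" "card (fst ` Z) \<le> ?d ^ (s + 3)"
    using zero_height_coordinates_card[OF assms False] unfolding Z_def s_def by auto
  \<comment> \<open>Second coordinates are first coordinates of image points, so bounding first
    coordinates is enough.\<close>
  have sub: "Z \<subseteq> fst ` Z \<times> fst ` Z"
    using zero_height_coordinate_dyn(1)[OF assms] unfolding Z_def by (force simp: mem_Times_iff)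
  then have fin: "finite Z" using U by (meson finite_SigmaI finite_subset)
  have "card Z \<le> card (fst ` Z) * card (fst ` Z)"
    using card_mono[OF _ sub] U by (simp add: card_cartesian_product)
  also have "\<dots> \<le> ?d ^ (s + 3) * ?d ^ (s + 3)" using U by (intro mult_mono) auto
  also have "\<dots> = ?d ^ (2 * s + 6)" by (simp add: power_add[symmetric])
  \<comment> \<open>\<open>2 * s + 6 \<le> 4 * (s + 1)\<close> amounts to
    \<open>1 \<le> s\<close>.\<close>
  also have "\<dots> \<le> ?d ^ (4 * (s + 1))" using U assms(2) by (intro power_increasing) auto
  also have "\<dots> \<le> (4 * ?d) ^ (4 * (s + 1))" by (intro power_mono) auto
  finally have card: "card Z \<le> zero_height_bound ?d s" unfolding zero_height_bound_def .
  have "periodic (henon 1 f) P" if "P \<in> Z" for P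
  proof (rule periodic_of_finite_orbit[OF inj_henon fin])
    show "(henon 1 f ^^ n) P \<in> Z" for n
      using that canonical_height_henon_eq_0_iff[OF assms] unfolding Z_def by (induction n) auto
  qed
  then show ?thesis
    using False fin card canonical_height_periodic[OF assms] unfolding Z_def s_def by blast
qed simp

end
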